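(* Let $\mathfrak{g}$ be a (finite dimensional, complex) semisimple Lie algebra with a non degenerate symmetric invariant bilinear form $B$ (not necessarily the Killing form). Any invariant even cyclic cochain $F\in\mathcal{M}_a^{2k}(\mathfrak{g})$ ($k\ge1$) defines a quadratic $2k$-Lie algebra on $\mathfrak{g}$; that is, $[F,F]_a=0$ and $B$ is $F$-invariant.
   Context: For $k\ge1$, $\mathcal{M}_a^k(\mathfrak{g})$ is the space of skew symmetric $k$-linear maps $\mathfrak{g}^k\to\mathfrak{g}$. With $\mathfrak{S}_{p,q}$ the set of permutations $\sigma\in\mathfrak{S}_{p+q}$ with $\sigma(1)<\dots<\sigma(p)$, $\sigma(p+1)<\dots<\sigma(p+q)$, for $F\in\mathcal{M}_a^{p+1}(\mathfrak{g})$, $G\in\mathcal{M}_a^{q+1}(\mathfrak{g})$: $$[F,G]_a(X_1,\dots,X_{p+q+1})=(-1)^{pq}\sum_{\sigma\in\mathfrak{S}_{q+1,p}}\varepsilon(\sigma)F(G(X_{\sigma(1)},\dots,X_{\sigma(q+1)}),X_{\sigma(q+2)},\dots,X_{\sigma(p+q+1)})-\sum_{\sigma\in\mathfrak{S}_{p+1,q}}\varepsilon(\sigma)G(F(X_{\sigma(1)},\dots,X_{\sigma(p+1)}),X_{\sigma(p+2)},\dots,X_{\sigma(p+q+1)}).$$ $F\in\mathcal{M}_a^{2k}(\mathfrak{g})$ is a $2k$-Lie algebra structure if $[F,F]_a=0$. $B$ is $F$-invariant (and $F$ is called quadratic) if $B(F(Y_1,\dots,Y_{2k-1},Y),Z)=-B(Y,F(Y_1,\dots,Y_{2k-1},Z))$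 for all $Y_1,\dots,Y_{2k-1},Y,Z\in\mathfrak{g}$. For $C\in\mathcal{M}_a^k(\mathfrak{g})$, $\hat C(Y_1,\dots,Y_{k+1})=B(C(Y_1,\dots,Y_k),Y_{k+1})$, and $C$ is a cyclic cochain if $\hat C(Y_1,\dots,Y_{k+1})=(-1)^k\hat C(Y_{k+1},Y_1,\dots,Y_k)$ for all $Y_i\in\mathfrak{g}$. $C$ is invariant if $[X,C(Y_1,\dots,Y_k)]=\sum_iC(Y_1,\dots,[X,Y_i],\dots,Y_k)$ for all $X,Y_i\in\mathfrak{g}$. An even cochain is one in $\mathcal{M}_a^{2k}(\mathfrak{g})$. *)

theory Defs
  imports Complex_Main "HOL-Combinatorics.Permutations"
begin

text \<open>The Lie algebra is the whole type \<open>'g\<close>, with scalar multiplication \<open>scale\<close> and bracket \<open>lie\<close>.\<close>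

locale lie_algebra = vector_space scale
  for scale :: "complex \<Rightarrow> 'g::ab_group_add \<Rightarrow> 'g" +
  fixes lie :: "'g \<Rightarrow> 'g \<Rightarrow> 'g"
  assumes lie_linear_right: "Vector_Spaces.linear scale scale (\<lambda>y. lie x y)"
    and lie_linear_left: "Vector_Spaces.linear scale scale (\<lambda>x. lie x y)"
    and lie_self: "lie x x = 0"
    and jacobi: "lie x (lie y z) + lie y (lie z x) + lie z (lie x y) = 0"
begin

definition lie_ideal :: "'g set \<Rightarrow> bool" where
  "lie_ideal I \<longleftrightarrow> subspace I \<and> (\<forall>x. \<forall>y\<in>I. lie x y \<in> I)"

definition derived :: "'g set \<Rightarrow> 'g set" where
  "derived I = span {lie x y | x y. x \<in> I \<and> y \<in> I}"

definition solvable :: "'g set \<Rightarrow> bool" where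
  "solvable I \<longleftrightarrow> (\<exists>n. (derived ^^ n) I = {0})"

definition semisimple :: bool where
  "semisimple \<longleftrightarrow> (\<forall>I. lie_ideal I \<and> solvable I \<longrightarrow> I = {0})"

end

definition bilinear_form ::
    "(complex \<Rightarrow> 'g::ab_group_add \<Rightarrow> 'g) \<Rightarrow> ('g \<Rightarrow> 'g \<Rightarrow> complex) \<Rightarrow> bool" where
  "bilinear_form scale B \<longleftrightarrow>
     (\<forall>x. Vector_Spaces.linear scale (*) (\<lambda>y. B x y)) \<and>
     (\<forall>y. Vector_Spaces.linear scale (*) (\<lambda>x. B x y))"

definition symmetric_form :: "('g \<Rightarrow> 'g \<Rightarrow> complex) \<Rightarrow> bool" where
  "symmetric_form B \<longleftrightarrow> (\<forall>x y. B x y = B y x)"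

definition nondegenerate_form :: "('g::zero \<Rightarrow> 'g \<Rightarrow> complex) \<Rightarrow> bool" where
  "nondegenerate_form B \<longleftrightarrow> (\<forall>x. (\<forall>y. B x y = 0) \<longrightarrow> x = 0)"

definition invariant_form :: "('g \<Rightarrow> 'g \<Rightarrow> 'g) \<Rightarrow> ('g \<Rightarrow> 'g \<Rightarrow> complex) \<Rightarrow> bool" where
  "invariant_form lie B \<longleftrightarrow> (\<forall>x y z. B (lie x y) z = - B y (lie x z))"

text \<open>
  A \<open>k\<close>-linear map is a function on lists, of which only the values on lists of length \<open>k\<close>
  matter; arguments are numbered from \<open>0\<close>.
\<close>

definition skew_cochains ::
    "(complex \<Rightarrow> 'g::ab_group_add \<Rightarrow> 'g) \<Rightarrow> nat \<Rightarrow> ('g list \<Rightarrow> 'g) set" where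
  "skew_cochains scale k = {C.
     (\<forall>xs ys. length xs + 1 + length ys = k \<longrightarrow>
        Vector_Spaces.linear scale scale (\<lambda>x. C (xs @ x # ys))) \<and>
     (\<forall>xs \<sigma>. length xs = k \<and> \<sigma> permutes {..<k} \<longrightarrow>
        C (permute_list \<sigma> xs) = scale (of_int (sign \<sigma>)) (C xs))}"

definition shuffles :: "nat \<Rightarrow> nat \<Rightarrow> (nat \<Rightarrow> nat) set" where
  "shuffles p q = {\<sigma>. \<sigma> permutes {..<p + q} \<and>
     strict_mono_on {..<p} \<sigma> \<and> strict_mono_on {p..<p + q} \<sigma>}"

text \<open>
  The bracket of a \<open>(p+1)\<close>-linear map \<open>F\<close> and a \<open>(q+1)\<close>-linear map \<open>G\<close>, to be
  evaluated on lists of length \<open>p + q + 1\<close>.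
\<close>

definition bracket_a ::
    "(complex \<Rightarrow> 'g::ab_group_add \<Rightarrow> 'g) \<Rightarrow> nat \<Rightarrow> nat \<Rightarrow>
     ('g list \<Rightarrow> 'g) \<Rightarrow> ('g list \<Rightarrow> 'g) \<Rightarrow> 'g list \<Rightarrow> 'g" where
  "bracket_a scale p q F G X =
     scale ((-1) ^ (p * q))
       (\<Sum>\<sigma>\<in>shuffles (q + 1) p. scale (of_int (sign \<sigma>))
          (F (G (take (q + 1) (permute_list \<sigma> X)) # drop (q + 1) (permute_list \<sigma> X))))
     - (\<Sum>\<sigma>\<in>shuffles (p + 1) q. scale (of_int (sign \<sigma>))
          (G (F (take (p + 1) (permute_list \<sigma> X)) # drop (p + 1) (permute_list \<sigma> X))))"

text \<open>A \<open>2k\<close>-Lie algebra structure, for \<open>k \<ge> 1\<close>; here \<open>p = q = 2k - 1\<close>.\<close>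

definition even_lie_structure ::
    "(complex \<Rightarrow> 'g::ab_group_add \<Rightarrow> 'g) \<Rightarrow> nat \<Rightarrow> ('g list \<Rightarrow> 'g) \<Rightarrow> bool" where
  "even_lie_structure scale k F \<longleftrightarrow> F \<in> skew_cochains scale (2 * k) \<and>
     (\<forall>X. length X = (2 * k - 1) + (2 * k - 1) + 1 \<longrightarrow>
        bracket_a scale (2 * k - 1) (2 * k - 1) F F X = 0)"

definition quadratic ::
    "('g \<Rightarrow> 'g \<Rightarrow> complex) \<Rightarrow> nat \<Rightarrow> ('g list \<Rightarrow> 'g) \<Rightarrow> bool" where
  "quadratic B k F \<longleftrightarrow> (\<forall>Ys Y Z. length Ys = 2 * k - 1 \<longrightarrow>
     B (F (Ys @ [Y])) Z = - B Y (F (Ys @ [Z])))"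

definition hat ::
    "('g \<Rightarrow> 'g \<Rightarrow> complex) \<Rightarrow> ('g list \<Rightarrow> 'g) \<Rightarrow> 'g list \<Rightarrow> complex" where
  "hat B C Y = B (C (butlast Y)) (last Y)"

definition cyclic_cochain ::
    "('g \<Rightarrow> 'g \<Rightarrow> complex) \<Rightarrow> nat \<Rightarrow> ('g list \<Rightarrow> 'g) \<Rightarrow> bool" where
  "cyclic_cochain B k C \<longleftrightarrow> (\<forall>Y. length Y = k + 1 \<longrightarrow>
     hat B C Y = (-1) ^ k * hat B C (last Y # butlast Y))"

definition invariant_cochain ::
    "('g \<Rightarrow> 'g \<Rightarrow> 'g::ab_group_add) \<Rightarrow> nat \<Rightarrow> ('g list \<Rightarrow> 'g) \<Rightarrow> bool" where
  "invariant_cochain lie k C \<longleftrightarrow> (\<forall>X Y. length Y = k \<longrightarrow>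
     lie X (C Y) = (\<Sum>i<k. C (Y[i := lie X (Y ! i)])))"

end

theory Submission
  imports Defs "Jordan_Normal_Form.Jordan_Normal_Form_Existence"
begin

text \<open>
  Write \<open>K\<close> for the Killing form and \<open>n = 2k\<close>. Cyclicity says that \<open>B (F X) y\<close> is alternating in all
  \<open>n + 1\<close> arguments. Expanding \<open>ad (F X)\<close> by invariance of \<open>F\<close> and taking adjoints with respect
  to \<open>B\<close> gives \<open>2 K(u, F X) = \<Sum>\<^sub>j tr (v \<mapsto> F(\<dots>, [[X\<^sub>j, u], v], \<dots>))\<close>, where the bracket
  replaces \<open>X\<^sub>j\<close>. By Cartan's criterion there is an equivariant \<open>R\<close> with \<open>K(R x, y) = B(x, y)\<close>, so with \<open>u = R (F Z)\<close>
  the number \<open>2 B(F Z, F X)\<close> is a sum of terms that depend on \<open>X\<^sub>j\<close> and \<open>Z\<close> only through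
  \<open>[X\<^sub>j, F Z]\<close>; antisymmetrising over \<open>X\<^sub>j\<close> and \<open>Z\<close> kills such a term, since the contractions of an
  invariant form are closed. As \<open>B(F(F Z, W), y) = - B(F Z, F(y, W))\<close>, doing this with \<open>X\<close> being once
  \<open>(y, W)\<close> and once the argument \<open>Z\<close> expresses the antisymmetrisation of \<open>2 B(F(F Z, W), y)\<close>
  by the same remaining term with opposite signs.
\<close>

section \<open>Traces\<close>

lemma linear_map_add: "Vector_Spaces.linear s1 s2 f \<Longrightarrow> f (x + y) = f x + f y"
  by (simp add: Vector_Spaces.linear_iff)

lemma linear_map_scale: "Vector_Spaces.linear s1 s2 f \<Longrightarrow> f (s1 c x) = s2 c (f x)"
  by (simp add: Vector_Spaces.linear_iff)

lemma linear_map_module_hom: "Vector_Spaces.linear s1 s2 f \<Longrightarrow> Modules.module_hom s1 s2 f"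
  by (simp add: linear_iff_module_hom)

lemmas linear_map_zero = Modules.module_hom.zero[OF linear_map_module_hom]
lemmas linear_map_neg = Modules.module_hom.neg[OF linear_map_module_hom]
lemmas linear_map_diff = Modules.module_hom.diff[OF linear_map_module_hom]
lemmas linear_map_sum = Modules.module_hom.sum[OF linear_map_module_hom]

lemma linear_map_comp:
  "Vector_Spaces.linear s2 s3 f \<Longrightarrow> Vector_Spaces.linear s1 s2 g \<Longrightarrow>
    Vector_Spaces.linear s1 s3 (\<lambda>x. f (g x))"
  by (simp add: Vector_Spaces.linear_iff)

context finite_dimensional_vector_space
begin

abbreviation lin :: "('b \<Rightarrow> 'b) \<Rightarrow> bool" where
  "lin T \<equiv> Vector_Spaces.linear scale scale T"

abbreviation functional :: "('b \<Rightarrow> 'a) \<Rightarrow> bool" where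
  "functional f \<equiv> Vector_Spaces.linear scale (*) f"

text \<open>A resolution of the identity by vectors \<open>e\<close> and functionals
  \<open>c\<close>, used in place of a basis: it is what computing a trace takes, and it fits the
  standard basis, a Jordan basis and a \<open>B\<close>-dual basis alike.\<close>

definition frame :: "'i set \<Rightarrow> ('i \<Rightarrow> 'b) \<Rightarrow> ('i \<Rightarrow> 'b \<Rightarrow> 'a) \<Rightarrow> bool" where
  "frame I e c \<longleftrightarrow> finite I \<and> (\<forall>i\<in>I. functional (c i)) \<and>
     (\<forall>x. (\<Sum>i\<in>I. scale (c i x) (e i)) = x)"

definition lin_trace :: "('b \<Rightarrow> 'b) \<Rightarrow> 'a" where
  "lin_trace T = (\<Sum>b\<in>Basis. representation Basis (T b) b)"

lemma linI:
  assumes "\<And>x y. T (x + y) = T x + T y" "\<And>c x. T (scale c x) = scale c (T x)"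
  shows "lin T"
  using assms vector_space_axioms by (auto simp: Vector_Spaces.linear_iff)

lemma functionalI:
  assumes "\<And>x y. f (x + y) = f x + f y" "\<And>c x. f (scale c x) = c * f x"
  shows "functional f"
proof -
  have "vector_space ((*) :: 'a \<Rightarrow> 'a \<Rightarrow> 'a)"
    by unfold_locales (simp_all add: algebra_simps)
  then show ?thesis
    using assms vector_space_axioms by (auto simp: Vector_Spaces.linear_iff)
qed

lemma functional_representation: "functional (\<lambda>x. representation Basis x b)"
  by (rule functionalI)
     (simp_all add: representation_add representation_scale span_Basis independent_Basis)

lemma frame_Basis: "frame Basis (\<lambda>b. b) (\<lambda>b x. representation Basis x b)"
  unfolding frame_def
  using finite_Basis functional_representation
  by (auto intro!: sum_representation_eq simp: span_Basis independent_Basis)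

lemma frame_functional: "frame I e c \<Longrightarrow> i \<in> I \<Longrightarrow> functional (c i)"
  by (simp add: frame_def)

lemma frame_sum: "frame I e c \<Longrightarrow> (\<Sum>i\<in>I. scale (c i x) (e i)) = x"
  by (simp add: frame_def)

lemma lin_frame:
  assumes "lin T" "frame I e c"
  shows "T x = (\<Sum>i\<in>I. scale (c i x) (T (e i)))"
proof -
  have "T x = T (\<Sum>i\<in>I. scale (c i x) (e i))"
    using frame_sum[OF assms(2)] by simp
  also have "\<dots> = (\<Sum>i\<in>I. scale (c i x) (T (e i)))"
    by (simp add: linear_map_sum[OF assms(1)] linear_map_scale[OF assms(1)])
  finally show ?thesis .
qed

lemma functional_frame:
  assumes "functional f" "frame I e c"
  shows "f x = (\<Sum>i\<in>I. c i x * f (e i))"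
proof -
  have "f x = f (\<Sum>i\<in>I. scale (c i x) (e i))"
    using frame_sum[OF assms(2)] by simp
  also have "\<dots> = (\<Sum>i\<in>I. c i x * f (e i))"
    by (simp add: linear_map_sum[OF assms(1)] linear_map_scale[OF assms(1)])
  finally show ?thesis .
qed

text \<open>Expanding \<open>T (e i)\<close> in \<open>d\<close> and \<open>S (d j)\<close> in
  \<open>e\<close> turns both sides into the same double sum. With \<open>T\<close> the identity
  this is independence of the frame; with equal frames it is tr(ST) = tr(TS).\<close>

lemma trace_two_frames:
  assumes S: "lin S" and T: "lin T" and e: "frame I e c" and d: "frame J d g"
  shows "(\<Sum>i\<in>I. c i (S (T (e i)))) = (\<Sum>j\<in>J. g j (T (S (d j))))"
proof -
  have "(\<Sum>i\<in>I. c i (S (T (e i)))) = (\<Sum>i\<in>I. \<Sum>j\<in>J. g j (T (e i)) * c i (S (d j)))"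
  proof (rule sum.cong[OF refl])
    fix i assume "i \<in> I"
    then have "functional (\<lambda>x. c i (S x))"
      using e S by (auto intro: linear_map_comp frame_functional)
    from functional_frame[OF this d]
    show "c i (S (T (e i))) = (\<Sum>j\<in>J. g j (T (e i)) * c i (S (d j)))" .
  qed
  also have "\<dots> = (\<Sum>j\<in>J. \<Sum>i\<in>I. g j (T (e i)) * c i (S (d j)))"
    by (rule sum.swap)
  also have "\<dots> = (\<Sum>j\<in>J. g j (T (S (d j))))"
  proof (rule sum.cong[OF refl])
    fix j assume "j \<in> J"
    then have "functional (\<lambda>x. g j (T x))"
      using d T by (auto intro: linear_map_comp frame_functional)
    from functional_frame[OF this e, of "S (d j)"]
    show "(\<Sum>i\<in>I. g j (T (e i)) * c i (S (d j))) = g j (T (S (d j)))"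
      by (simp add: mult.commute)
  qed
  finally show ?thesis .
qed

lemma lin_ident: "lin (\<lambda>x. x)"
  by (rule linI) simp_all

lemma trace_frame:
  assumes "lin T" "frame I e c"
  shows "lin_trace T = (\<Sum>i\<in>I. c i (T (e i)))"
  unfolding lin_trace_def
  using trace_two_frames[OF assms(1) lin_ident frame_Basis assms(2)] by simp

lemma trace_comm:
  assumes "lin S" "lin T"
  shows "lin_trace (\<lambda>x. S (T x)) = lin_trace (\<lambda>x. T (S x))"
  unfolding lin_trace_def
  using trace_two_frames[OF assms frame_Basis frame_Basis] by simp

lemma trace_add: "lin_trace (\<lambda>x. S x + T x) = lin_trace S + lin_trace T"
  by (simp add: lin_trace_def representation_add span_Basis independent_Basis sum.distrib)

lemma trace_neg: "lin_trace (\<lambda>x. - T x) = - lin_trace T"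
  by (simp add: lin_trace_def representation_neg span_Basis independent_Basis sum_negf)

lemma trace_diff: "lin_trace (\<lambda>x. S x - T x) = lin_trace S - lin_trace T"
  by (simp add: lin_trace_def representation_diff span_Basis independent_Basis sum_subtractf)

lemma trace_scale: "lin_trace (\<lambda>x. scale a (T x)) = a * lin_trace T"
  by (simp add: lin_trace_def representation_scale span_Basis independent_Basis sum_distrib_left)

lemma trace_zero: "lin_trace (\<lambda>x. 0) = 0"
  by (simp add: lin_trace_def representation_zero)

lemma trace_sum: "finite J \<Longrightarrow> lin_trace (\<lambda>x. \<Sum>j\<in>J. T j x) = (\<Sum>j\<in>J. lin_trace (T j))"
  by (induction J rule: finite_induct) (simp_all add: trace_add trace_zero)

text \<open>\<open>L\<close> records the functional x -> B(x, y) by its values on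
  \<open>Basis\<close>. Nondegeneracy makes \<open>L\<close> injective, hence surjective by
  dimension, so the values of \<open>f\<close> are attained.\<close>

lemma riesz:
  assumes B1: "\<And>y. functional (\<lambda>x. B x y)" and B2: "\<And>x. functional (\<lambda>y. B x y)"
    and nd: "\<And>y. (\<And>x. B x y = 0) \<Longrightarrow> y = 0" and f: "functional f"
  obtains y where "\<And>x. B x y = f x"
proof -
  define L where "L y = (\<Sum>b\<in>Basis. scale (B b y) b)" for y
  have L: "lin L"
    unfolding L_def
    by (rule linI)
       (simp_all add: linear_map_add[OF B2] linear_map_scale[OF B2] scale_left_distrib
         sum.distrib scale_sum_right)
  have rep: "representation Basis (\<Sum>b\<in>Basis. scale (h b) b) b = h b" if "b \<in> Basis" for h b
  proof -
    have "representation Basis (\<Sum>b\<in>Basis. scale (h b) b) b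
        = (\<Sum>a\<in>Basis. h a * representation Basis a b)"
      by (simp add: linear_map_sum[OF functional_representation]
          linear_map_scale[OF functional_representation])
    also have "\<dots> = (\<Sum>a\<in>Basis. if b = a then h b else 0)"
      by (rule sum.cong) (auto simp: representation_basis independent_Basis)
    also have "\<dots> = h b"
      using that finite_Basis by simp
    finally show ?thesis .
  qed
  have "inj L"
  proof (rule injI)
    fix y z assume "L y = L z"
    then have "L (y - z) = 0"
      using linear_map_diff[OF L] by simp
    then have "B b (y - z) = 0" if "b \<in> Basis" for b
      using rep[OF that, of "\<lambda>b. B b (y - z)"] by (simp add: L_def representation_zero)
    then have "B x (y - z) = 0" for x
      by (subst functional_frame[OF B1 frame_Basis]) simp
    then show "y = z"
      using nd[of "y - z"] by simp
  qed
  then have "surj L"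
    by (rule linear_inj_imp_surj[OF L])
  then obtain y where y: "L y = (\<Sum>b\<in>Basis. scale (f b) b)"
    by (metis surjD)
  have "B b y = f b" if "b \<in> Basis" for b
    using rep[OF that, of "\<lambda>b. B b y"] rep[OF that, of f] y by (simp add: L_def)
  then have "B x y = f x" for x
    by (subst functional_frame[OF B1 frame_Basis], subst functional_frame[OF f frame_Basis]) simp
  then show ?thesis
    using that by blast
qed

text \<open>The vectors \<open>u b\<close> are dual to \<open>Basis\<close> under \<open>B\<close>,
  so they form a frame with coordinates B(b, -). In it tr T is the sum of B(b, T(u b)) = B(S b, u
  b), which is tr S computed in \<open>Basis\<close>.\<close>

lemma trace_adjoint:
  assumes B1: "\<And>y. functional (\<lambda>x. B x y)" and B2: "\<And>x. functional (\<lambda>y. B x y)"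
    and nd: "\<And>y. (\<And>x. B x y = 0) \<Longrightarrow> y = 0"
    and S: "lin S" and T: "lin T" and adj: "\<And>x y. B (S x) y = B x (T y)"
  shows "lin_trace S = lin_trace T"
proof -
  have "\<exists>y. \<forall>x. B x y = representation Basis x b" for b
    using riesz[of B, OF B1 B2 nd functional_representation[of b]] by metis
  then obtain u where u: "\<And>x b. B x (u b) = representation Basis x b"
    by metis
  have "frame Basis u (\<lambda>b y. B b y)"
    unfolding frame_def
  proof (intro conjI ballI allI)
    fix y
    have "B x ((\<Sum>b\<in>Basis. scale (B b y) (u b)) - y) = 0" for x
    proof -
      have "B x (\<Sum>b\<in>Basis. scale (B b y) (u b)) = (\<Sum>b\<in>Basis. representation Basis x b * B b y)"
        by (simp add: linear_map_sum[OF B2] linear_map_scale[OF B2] u mult.commute)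
      also have "\<dots> = B x y"
        by (rule functional_frame[OF B1 frame_Basis, symmetric])
      finally show ?thesis
        by (simp add: linear_map_diff[OF B2])
    qed
    from nd[OF this] show "(\<Sum>b\<in>Basis. scale (B b y) (u b)) = y"
      by simp
  qed (simp_all add: finite_Basis B2)
  from trace_frame[OF T this] show ?thesis
    by (simp add: lin_trace_def flip: u adj)
qed

end

section \<open>Jordan bases of linear maps\<close>

text \<open>Induction over the blocks: a nonzero entry has both indices in the first block or both
  beyond it, and within a block only the superdiagonal joins the constant diagonal.\<close>

lemma jordan_matrix_superdiagonal:
  fixes n_as :: "(nat \<times> 'a::zero_neq_one) list"
  assumes "i < sum_list (map fst n_as)" "j < sum_list (map fst n_as)"
    and "jordan_matrix n_as $$ (i, j) \<noteq> 0" "i \<noteq> j"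
  shows "j = Suc i \<and> jordan_matrix n_as $$ (i, i) = jordan_matrix n_as $$ (j, j)"
  using assms
proof (induction n_as arbitrary: i j)
  case (Cons p n_as)
  obtain n a where p: "p = (n, a)"
    by force
  show ?case
  proof (cases "i < n \<or> j < n")
    case True
    then show ?thesis
      using Cons.prems unfolding p jordan_matrix_Cons by (auto split: if_splits)
  next
    case False
    then have "j - n = Suc (i - n) \<and>
        jordan_matrix n_as $$ (i - n, i - n) = jordan_matrix n_as $$ (j - n, j - n)"
      using Cons.prems by (intro Cons.IH) (auto simp: p jordan_matrix_Cons)
    with False Cons.prems show ?thesis
      unfolding p jordan_matrix_Cons by auto
  qed
qed simp

text \<open>The Jordan normal form carried from matrices to a linear map: \<open>e\<close> is read
  off the columns of \<open>P\<close>, the dual coordinates \<open>c\<close> off the rows of its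
  inverse \<open>Q\<close>, and \<open>M * P = P * J\<close> gives the action. The block structure
  survives in the last clause: a nonzero superdiagonal entry joins equal eigenvalues.\<close>

lemma jordan_basis:
  fixes scale :: "complex \<Rightarrow> 'g::ab_group_add \<Rightarrow> 'g"
  assumes fd: "finite_dimensional_vector_space scale Basis"
    and A: "Vector_Spaces.linear scale scale A"
  obtains n :: nat and e c l s where
    "finite_dimensional_vector_space.frame scale {..<n} e c"
    "\<And>i j. i < n \<Longrightarrow> j < n \<Longrightarrow> c i (e j) = (if i = j then 1 else 0)"
    "\<And>j. j < n \<Longrightarrow> A (e j) = scale (l j) (e j) + (if j = 0 then 0 else scale (s j) (e (j - 1)))"
    "\<And>j. 0 < j \<Longrightarrow> j < n \<Longrightarrow> s j \<noteq> 0 \<Longrightarrow> l (j - 1) = l j"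
proof -
  interpret finite_dimensional_vector_space scale Basis
    by (rule fd)
  obtain n and b :: "nat \<Rightarrow> 'g" where b: "bij_betw b {..<n} Basis"
    using ex_bij_betw_nat_finite[OF finite_Basis] by (auto simp: atLeast0LessThan)
  define r where "r i x = representation Basis x (b i)" for i x
  have r: "functional (r i)" for i
    unfolding r_def by (rule functional_representation)
  have fr: "frame {..<n} b r"
    unfolding frame_def
  proof (intro conjI ballI allI)
    show "(\<Sum>i<n. scale (r i x) (b i)) = x" for x
      unfolding r_def sum.reindex_bij_betw[OF b, of "\<lambda>b. scale (representation Basis x b) b"]
      by (rule frame_sum[OF frame_Basis])
  qed (simp_all add: r)
  have rb: "r i (b j) = (if i = j then 1 else 0)" if "i < n" "j < n" for i j
  proof -
    have "b j \<in> Basis" "b i = b j \<longleftrightarrow> i = j"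
      using that b by (auto simp: bij_betw_def inj_on_def)
    then show ?thesis
      unfolding r_def by (simp add: representation_basis independent_Basis)
  qed
  define M where "M = mat n n (\<lambda>(i, j). r i (A (b j)))"
  have M: "M \<in> carrier_mat n n"
    by (simp add: M_def)
  obtain as where "char_poly M = (\<Prod>a\<leftarrow>as. [:- a, 1:])"
    using char_poly_factorized[OF M] by blast
  then obtain n_as where "jordan_nf M n_as"
    using jordan_nf_exists[OF M] by blast
  then have sim: "similar_mat M (jordan_matrix n_as)"
    by (simp add: jordan_nf_def)
  define J where "J = jordan_matrix n_as"
  obtain m P Q where mpq: "{M, J, P, Q} \<subseteq> carrier_mat m m" "P * Q = 1\<^sub>m m" "Q * P = 1\<^sub>m m"
      "M = P * J * Q"
    using similar_matD[OF sim] unfolding J_def by blast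
  have m: "m = n"
    using mpq(1) M by auto
  have P: "P \<in> carrier_mat n n" and Q: "Q \<in> carrier_mat n n" and J: "J \<in> carrier_mat n n"
    using mpq(1) m by auto
  have n: "n = sum_list (map fst n_as)"
    using J unfolding J_def by auto
  have MP: "M * P = P * J"
    using mpq(2-4) P Q J m by (simp add: assoc_mult_mat[of _ n n _ n _ n])
  define e where "e j = (\<Sum>i<n. scale (P $$ (i, j)) (b i))" for j
  define c where "c j x = (\<Sum>i<n. Q $$ (j, i) * r i x)" for j x
  have index_mult: "(X * Y) $$ (i, j) = (\<Sum>k<n. X $$ (i, k) * Y $$ (k, j))"
    if "X \<in> carrier_mat n n" "Y \<in> carrier_mat n n" "i < n" "j < n" for X Y :: "complex mat" and i j
    using that by (auto simp: scalar_prod_def atLeast0LessThan intro!: sum.cong)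
  have re: "r i (e j) = P $$ (i, j)" if "i < n" for i j
  proof -
    have "r i (e j) = (\<Sum>k<n. if i = k then P $$ (k, j) else 0)"
      unfolding e_def using that
      by (simp add: linear_map_sum[OF r] linear_map_scale[OF r] rb if_distrib cong: if_cong)
    then show ?thesis
      using that by simp
  qed
  have "frame {..<n} e c"
    unfolding frame_def
  proof (intro conjI ballI allI)
    fix x
    have "(\<Sum>j<n. scale (c j x) (e j))
        = (\<Sum>j<n. \<Sum>i<n. \<Sum>k<n. scale (Q $$ (j, k) * r k x * P $$ (i, j)) (b i))"
      unfolding c_def e_def scale_sum_right
      by (simp add: sum_distrib_right scale_sum_left)
    also have "\<dots> = (\<Sum>i<n. \<Sum>j<n. \<Sum>k<n. scale (Q $$ (j, k) * r k x * P $$ (i, j)) (b i))"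
      by (rule sum.swap)
    also have "\<dots> = (\<Sum>i<n. \<Sum>k<n. \<Sum>j<n. scale (Q $$ (j, k) * r k x * P $$ (i, j)) (b i))"
      by (intro sum.cong refl sum.swap)
    also have "\<dots> = (\<Sum>i<n. \<Sum>k<n. scale ((P * Q) $$ (i, k) * r k x) (b i))"
      by (intro sum.cong refl)
         (simp add: index_mult[OF P Q] sum_distrib_right sum_distrib_left mult_ac flip: scale_sum_left del: index_mult_mat)
    also have "\<dots> = (\<Sum>i<n. \<Sum>k<n. if i = k then scale (r k x) (b i) else 0)"
      by (intro sum.cong refl) (simp add: mpq(2) m)
    also have "\<dots> = x"
      using frame_sum[OF fr, of x] by simp
    finally show "(\<Sum>j<n. scale (c j x) (e j)) = x" .
  next
    show "functional (c j)" for j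
      unfolding c_def
      by (rule functionalI)
         (simp_all add: linear_map_add[OF r] linear_map_scale[OF r] distrib_left sum.distrib
           sum_distrib_left mult_ac)
  qed simp
  moreover have "c i (e j) = (if i = j then 1 else 0)" if "i < n" "j < n" for i j
  proof -
    have "c i (e j) = (Q * P) $$ (i, j)"
      unfolding c_def using that by (simp add: re index_mult[OF Q P] del: index_mult_mat)
    then show ?thesis
      using that by (simp add: mpq(3) m)
  qed
  moreover have "A (e j) = scale (J $$ (j, j)) (e j) +
      (if j = 0 then 0 else scale (J $$ (j - 1, j)) (e (j - 1)))" if j: "j < n" for j
  proof -
    have "A (e j) = (\<Sum>i<n. scale (P $$ (i, j)) (\<Sum>k<n. scale (M $$ (k, i)) (b k)))"
      unfolding e_def linear_map_sum[OF A] linear_map_scale[OF A]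
      by (rule sum.cong) (auto simp: M_def frame_sum[OF fr])
    also have "\<dots> = (\<Sum>k<n. \<Sum>i<n. scale (M $$ (k, i) * P $$ (i, j)) (b k))"
      by (subst sum.swap) (simp add: scale_sum_right mult.commute)
    also have "\<dots> = (\<Sum>k<n. scale ((P * J) $$ (k, j)) (b k))"
      using j by (simp add: index_mult[OF M P] scale_sum_left flip: MP del: index_mult_mat)
    also have "\<dots> = (\<Sum>k<n. \<Sum>i<n. scale (P $$ (k, i) * J $$ (i, j)) (b k))"
      using j by (simp add: index_mult[OF P J] scale_sum_left del: index_mult_mat)
    also have "\<dots> = (\<Sum>i<n. scale (J $$ (i, j)) (e i))"
      unfolding e_def scale_sum_right by (subst sum.swap) (simp add: mult.commute)
    \<comment> \<open>Column \<open>j\<close> lives in rows \<open>j\<close> and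
      \<open>j - 1\<close>; the latter is left out for \<open>j = 0\<close>, where natural
      subtraction would return row 0 again.\<close>
    also have "\<dots> = (\<Sum>i\<in>{j} \<union> (if j = 0 then {} else {j - 1}). scale (J $$ (i, j)) (e i))"
    proof (rule sum.mono_neutral_right)
      show "\<forall>i\<in>{..<n} - ({j} \<union> (if j = 0 then {} else {j - 1})). scale (J $$ (i, j)) (e i) = 0"
      proof
        fix i assume "i \<in> {..<n} - ({j} \<union> (if j = 0 then {} else {j - 1}))"
        then have "i < n" "i \<noteq> j" "j \<noteq> Suc i"
          by (auto split: if_splits)
        then have "J $$ (i, j) = 0"
          using jordan_matrix_superdiagonal[of i n_as j] j unfolding J_def n by blast
        then show "scale (J $$ (i, j)) (e i) = 0"
          by simp
      qed
    qed (use j in auto)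
    also have "\<dots> = scale (J $$ (j, j)) (e j) +
        (if j = 0 then 0 else scale (J $$ (j - 1, j)) (e (j - 1)))"
      by auto
    finally show ?thesis .
  qed
  moreover have "J $$ (j - 1, j - 1) = J $$ (j, j)" if "0 < j" "j < n" "J $$ (j - 1, j) \<noteq> 0" for j
    using jordan_matrix_superdiagonal[of "j - 1" n_as j] that unfolding J_def n by auto
  ultimately show ?thesis
    using that[of n e c "\<lambda>j. J $$ (j, j)" "\<lambda>j. J $$ (j - 1, j)"] by blast
qed


section \<open>Cartan's criterion\<close>

locale fd_lie_algebra = finite_dimensional_vector_space scale Basis + lie_algebra scale lie
  for scale :: "complex \<Rightarrow> 'g::ab_group_add \<Rightarrow> 'g" and Basis :: "'g set"
    and lie :: "'g \<Rightarrow> 'g \<Rightarrow> 'g"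
begin

lemmas lie_add_right = linear_map_add[OF lie_linear_right]
lemmas lie_scale_right = linear_map_scale[OF lie_linear_right]
lemmas lie_zero_right = linear_map_zero[OF lie_linear_right]
lemmas lie_neg_right = linear_map_neg[OF lie_linear_right]
lemmas lie_diff_right = linear_map_diff[OF lie_linear_right]
lemmas lie_sum_right = linear_map_sum[OF lie_linear_right]
lemmas lie_add_left = linear_map_add[OF lie_linear_left]
lemmas lie_scale_left = linear_map_scale[OF lie_linear_left]
lemmas lie_zero_left = linear_map_zero[OF lie_linear_left]
lemmas lie_diff_left = linear_map_diff[OF lie_linear_left]

lemma lie_skew: "lie x y = - lie y x"
proof -
  have "lie x y + lie y x = lie (x + y) (x + y)"
    by (simp add: lie_add_left lie_add_right lie_self[of x] lie_self[of y])
  also have "\<dots> = 0"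
    by (rule lie_self)
  finally show ?thesis
    by (simp add: eq_neg_iff_add_eq_0)
qed

lemma lie_leibniz: "lie x (lie y z) = lie (lie x y) z + lie y (lie x z)"
  using jacobi[of x y z] lie_skew[of z "lie x y"] lie_skew[of z x]
  by (simp add: lie_neg_right algebra_simps add_eq_0_iff)

lemma lie_lie_left: "lie (lie x y) z = lie x (lie y z) - lie y (lie x z)"
  using lie_leibniz[of x y z] by simp

section \<open>Derivations and generalised eigenspaces\<close>

definition derivation :: "('g \<Rightarrow> 'g) \<Rightarrow> bool" where
  "derivation T \<longleftrightarrow> lin T \<and> (\<forall>v w. T (lie v w) = lie (T v) w + lie v (T w))"

lemma derivation_lie: "derivation (lie x)"
  unfolding derivation_def using lie_linear_right lie_leibniz by blast

lemma lin_funpow: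
  assumes "lin T"
  shows "lin (T ^^ m)"
proof (induction m)
  case 0
  show ?case
    using lin_ident by (simp add: id_def)
next
  case (Suc m)
  show ?case
    using linear_map_comp[OF assms Suc] by (simp add: o_def)
qed

text \<open>A - (a + b) acts on \<open>lie v w\<close> as A - a on \<open>v\<close> plus A - b on
  \<open>w\<close>, so each summand has one exponent lowered and induction on p + q applies; it ends
  with \<open>v = 0\<close> or \<open>w = 0\<close>. Hence eigenvalues add under the bracket of
  generalised eigenvectors.\<close>

lemma funpow_derivation_shift_lie:
  assumes A: "derivation A"
    and "((\<lambda>x. A x - scale a x) ^^ p) v = 0" "((\<lambda>x. A x - scale b x) ^^ q) w = 0"
  shows "((\<lambda>x. A x - scale (a + b) x) ^^ (p + q)) (lie v w) = 0"
  using assms(2,3)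
proof (induction "p + q" arbitrary: p q v w rule: less_induct)
  case less
  let ?T = "\<lambda>z x. A x - scale z x"
  have lin_A: "lin A"
    using A by (simp add: derivation_def)
  have T: "lin (?T z)" for z
    by (rule linI) (simp_all add: linear_map_add[OF lin_A] linear_map_scale[OF lin_A]
        algebra_simps)
  have T0: "(?T z ^^ m) 0 = 0" for z m
    by (rule linear_map_zero[OF lin_funpow[OF T]])
  show ?case
  proof (cases "p = 0 \<or> q = 0")
    case True
    then have "lie v w = 0"
      using less.prems by (auto simp: lie_zero_left lie_zero_right)
    then show ?thesis
      by (simp add: T0)
  next
    case False
    then obtain p' q' where pq: "p = Suc p'" "q = Suc q'"
      by (meson not0_implies_Suc)
    have step: "?T (a + b) (lie v w) = lie (?T a v) w + lie v (?T b w)"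
      using A by (simp add: derivation_def lie_diff_left lie_diff_right lie_scale_left
          lie_scale_right scale_left_distrib)
    have "(?T a ^^ p') (?T a v) = 0" "(?T b ^^ q') (?T b w) = 0"
      using less.prems unfolding pq funpow_Suc_right by simp_all
    then have "(?T (a + b) ^^ (p' + q)) (lie (?T a v) w) = 0"
        "(?T (a + b) ^^ (p + q')) (lie v (?T b w)) = 0"
      using less.hyps[of p' q "?T a v" w] less.hyps[of p q' v "?T b w"] less.prems pq by auto
    moreover have "p + q = Suc (p' + q)" "p + q' = p' + q"
      using pq by auto
    ultimately show ?thesis
      unfolding \<open>p + q = Suc (p' + q)\<close> funpow_Suc_right o_apply step
      by (simp add: linear_map_add[OF lin_funpow[OF T]])
  qed
qed

text \<open>The derivation acts on the generalised eigenspace of \<open>A\<close> for \<open>\<lambda>\<close> as the conjugate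
  of \<open>\<lambda>\<close>, so that its product with \<open>A\<close> has trace \<open>\<Sum> \<bar>\<lambda>\<bar>\<^sup>2\<close>.\<close>

lemma conjugate_derivation:
  assumes "derivation A"
  obtains D where "derivation D" "lin_trace (\<lambda>x. D (A x)) = 0 \<Longrightarrow> \<exists>m. \<forall>v. (A ^^ m) v = 0"
proof -
  have A: "lin A"
    using assms by (simp add: derivation_def)
  have fd: "finite_dimensional_vector_space scale Basis"
    by (rule finite_dimensional_vector_space_axioms)
  obtain n :: nat and e c l s where fr: "frame {..<n} e c"
    and ce: "\<And>i j. i < n \<Longrightarrow> j < n \<Longrightarrow> c i (e j) = (if i = j then 1 else 0)"
    and Ae: "\<And>j. j < n \<Longrightarrow> A (e j) = scale (l j) (e j) + (if j = 0 then 0 else scale (s j) (e (j - 1)))"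
    and sl: "\<And>j. 0 < j \<Longrightarrow> j < n \<Longrightarrow> s j \<noteq> 0 \<Longrightarrow> l (j - 1) = l j"
    by (rule jordan_basis[OF fd A]) blast
  have c: "functional (c j)" if "j < n" for j
    using frame_functional[OF fr] that by simp
  define T where "T z x = A x - scale z x" for z x
  have T: "lin (T z)" for z
    unfolding T_def
    by (rule linI) (simp_all add: linear_map_add[OF A] linear_map_scale[OF A] algebra_simps)
  \<comment> \<open>A - l j sends \<open>e j\<close> to a multiple of \<open>e (j - 1)\<close> that
    is zero unless both have the same eigenvalue; after j + 1 applications nothing is left.\<close>
  have eigen: "(T (l j) ^^ Suc j) (e j) = 0" if "j < n" for j
    using that
  proof (induction j)
    case 0
    then show ?case
      by (simp add: T_def Ae)
  next
    case (Suc i)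
    have "T (l (Suc i)) (e (Suc i)) = scale (s (Suc i)) (e i)"
      using Suc.prems by (simp add: T_def Ae)
    then have *: "(T (l (Suc i)) ^^ Suc (Suc i)) (e (Suc i))
        = scale (s (Suc i)) ((T (l (Suc i)) ^^ Suc i) (e i))"
      unfolding funpow_Suc_right[of "Suc i"] by (simp add: linear_map_scale[OF lin_funpow[OF T]] del: funpow.simps)
    show ?case
    proof (cases "s (Suc i) = 0")
      case True
      then show ?thesis
        unfolding * by simp
    next
      case False
      then have "l i = l (Suc i)"
        using sl[of "Suc i"] Suc.prems by simp
      then show ?thesis
        unfolding * using Suc.IH Suc.prems by simp
    qed
  qed
  have cA: "c j (A v) = l j * c j v + (if Suc j < n then s (Suc j) * c (Suc j) v else 0)"
    if j: "j < n" for j v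
  proof -
    have "c j (A v) = (\<Sum>i<n. c i v * c j (A (e i)))"
      by (rule functional_frame[OF linear_map_comp[OF c[OF j] A] fr])
    also have "\<dots> = (\<Sum>i<n. (if i = j then c j v * l j else 0)
        + (if i = Suc j then s (Suc j) * c (Suc j) v else 0))"
    proof (rule sum.cong[OF refl])
      fix i assume i: "i \<in> {..<n}"
      show "c i v * c j (A (e i)) = (if i = j then c j v * l j else 0)
          + (if i = Suc j then s (Suc j) * c (Suc j) v else 0)"
        using i j
        by (cases i) (auto simp: Ae ce linear_map_add[OF c] linear_map_scale[OF c] linear_map_zero[OF c])
    qed
    also have "\<dots> = l j * c j v + (if Suc j < n then s (Suc j) * c (Suc j) v else 0)"
      using j by (simp add: sum.distrib mult.commute)
    finally show ?thesis .
  qed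
  \<comment> \<open>A generalised eigenvector for \<open>z\<close> has no coordinates at other
    eigenvalues. The inner induction runs from the top index down: \<open>c (Suc j) v\<close> is
    already 0 if \<open>s (Suc j)\<close> is not, so \<open>T z\<close> multiplies
    \<open>c j v\<close> by the nonzero l j - z.\<close>
  have support: "c j v = 0" if "(T z ^^ m) v = 0" "j < n" "l j \<noteq> z" for z m v j
    using that
  proof (induction m arbitrary: v j)
    case 0
    then show ?case
      by (simp add: linear_map_zero[OF c])
  next
    case (Suc m)
    have T0: "c i (T z v) = 0" if "i < n" "l i \<noteq> z" for i
      using Suc.IH[of "T z v" i] Suc.prems(1) that unfolding funpow_Suc_right by simp
    show ?case
      using Suc.prems(2,3)
    proof (induction "n - j" arbitrary: j rule: less_induct)
      case less
      have "s (Suc j) * c (Suc j) v = 0" if "Suc j < n"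
        using less.hyps[of "Suc j"] less.prems that sl[of "Suc j"] by fastforce
      then have "c j (T z v) = (l j - z) * c j v"
        using cA[OF less.prems(1), of v] less.prems
        by (simp add: T_def linear_map_diff[OF c] linear_map_scale[OF c] algebra_simps)
      then show ?case
        using T0[OF less.prems] less.prems by simp
    qed
  qed
  \<comment> \<open>Diagonal in the Jordan basis, hence by \<open>support\<close> the scalar
    \<open>cnj z\<close> on every generalised eigenvector for \<open>z\<close>.\<close>
  define D where "D x = (\<Sum>i<n. scale (cnj (l i) * c i x) (e i))" for x
  have D: "lin D"
    unfolding D_def
    by (rule linI) (simp_all add: linear_map_add[OF c] linear_map_scale[OF c] algebra_simps
        sum.distrib scale_sum_right)
  have D_eigen: "D v = scale (cnj z) v" if "(T z ^^ m) v = 0" for z m v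
  proof -
    have "D v = (\<Sum>i<n. scale (cnj z) (scale (c i v) (e i)))"
      unfolding D_def
    proof (rule sum.cong[OF refl])
      fix i assume "i \<in> {..<n}"
      then show "scale (cnj (l i) * c i v) (e i) = scale (cnj z) (scale (c i v) (e i))"
        using support[OF that, of i] by (cases "l i = z") auto
    qed
    then show ?thesis
      unfolding scale_sum_right[symmetric] frame_sum[OF fr] .
  qed
  \<comment> \<open>The defect of \<open>D\<close> in the Leibniz rule. It is bilinear and vanishes
    on pairs of Jordan vectors, because their eigenvalues add under the bracket and
    \<open>cnj\<close> is additive.\<close>
  define E where "E v w = D (lie v w) - lie (D v) w - lie v (D w)" for v w
  have E1: "lin (\<lambda>v. E v w)" and E2: "lin (\<lambda>w. E v w)" for v w
    unfolding E_def
    by (rule linI; simp add: linear_map_add[OF D] linear_map_scale[OF D] lie_add_left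
        lie_add_right lie_scale_left lie_scale_right scale_right_diff_distrib)+
  have E0: "E (e i) (e j) = 0" if "i < n" "j < n" for i j
  proof -
    have "(T (l i + l j) ^^ (Suc i + Suc j)) (lie (e i) (e j)) = 0"
      using funpow_derivation_shift_lie[OF assms] eigen[OF that(1)] eigen[OF that(2)]
      unfolding T_def by blast
    from D_eigen[OF this] D_eigen[OF eigen[OF that(1)]] D_eigen[OF eigen[OF that(2)]]
    show ?thesis
      by (simp add: E_def lie_scale_left lie_scale_right scale_left_distrib)
  qed
  have "E v w = 0" for v w
  proof -
    have "E (e i) w = 0" if "i < n" for i
      using lin_frame[OF E2 fr, of "e i" w] E0[OF that] by simp
    then show ?thesis
      using lin_frame[OF E1 fr, of v w] by simp
  qed
  then have "derivation D"
    unfolding derivation_def E_def using D by (auto simp: algebra_simps)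
  moreover have "\<exists>m. \<forall>v. (A ^^ m) v = 0" if tr: "lin_trace (\<lambda>x. D (A x)) = 0"
  proof -
    have cD: "c j (D y) = cnj (l j) * c j y" if "j < n" for j y
    proof -
      have "c j (D y) = (\<Sum>i<n. if i = j then cnj (l i) * c i y else 0)"
        unfolding D_def linear_map_sum[OF c[OF that]] linear_map_scale[OF c[OF that]]
        by (rule sum.cong) (use that in \<open>auto simp: ce\<close>)
      then show ?thesis
        using that by simp
    qed
    \<comment> \<open>The superdiagonal of \<open>A\<close> does not reach the trace, which is
      therefore a sum of squared moduli. If it is 0, all eigenvalues vanish and \<open>eigen\<close>
      speaks of powers of \<open>A\<close> itself.\<close>
    have "lin_trace (\<lambda>x. D (A x)) = (\<Sum>j<n. c j (D (A (e j))))"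
      by (rule trace_frame[OF linear_map_comp[OF D A] fr])
    also have "\<dots> = (\<Sum>j<n. of_real ((norm (l j))\<^sup>2))"
      by (rule sum.cong) (auto simp: cD cA ce complex_norm_square mult.commute simp del: of_real_power)
    also have "\<dots> = of_real (\<Sum>j<n. (norm (l j))\<^sup>2)"
      by simp
    finally have "(\<Sum>j<n. (norm (l j))\<^sup>2) = 0"
      using tr by (metis of_real_eq_0_iff)
    then have l0: "l j = 0" if "j < n" for j
      using that by (subst (asm) sum_nonneg_eq_0_iff) auto
    have T_0: "T 0 = A"
      by (simp add: T_def fun_eq_iff)
    have "(A ^^ n) (e j) = 0" if "j < n" for j
    proof -
      have "(A ^^ (n - Suc j)) ((A ^^ Suc j) (e j)) = 0"
        using eigen[OF that] by (simp add: l0[OF that] T_0 linear_map_zero[OF lin_funpow[OF A]])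
      then show ?thesis
        using that by (metis Suc_leI funpow_add le_add_diff_inverse2 o_apply)
    qed
    then have "(A ^^ n) v = 0" for v
      using lin_frame[OF lin_funpow[OF A] fr, of n v] by simp
    then show ?thesis
      by blast
  qed
  ultimately show ?thesis
    using that by blast
qed

section \<open>Engel's theorem\<close>

text \<open>Member \<open>m\<close> consists of the vectors killed by every \<open>m\<close>-fold
  product of maps \<open>lie h\<close> with \<open>h\<close> in \<open>H\<close>; so the value
  \<open>UNIV\<close> at \<open>N\<close> says that all products of \<open>N\<close> such maps
  vanish.\<close>

fun annihilator_series :: "'g set \<Rightarrow> nat \<Rightarrow> 'g set" where
  "annihilator_series H 0 = {0}"
| "annihilator_series H (Suc m) = {v. \<forall>h\<in>H. lie h v \<in> annihilator_series H m}"

lemma subspace_annihilator_series: "subspace (annihilator_series H m)"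
proof (induction m)
  case (Suc m)
  then show ?case
    unfolding subspace_def by (simp add: lie_zero_right lie_add_right lie_scale_right)
qed (simp add: subspace_def)

lemma annihilator_series_Suc_mono: "annihilator_series H m \<subseteq> annihilator_series H (Suc m)"
  by (induction m) (auto simp: lie_zero_right)

lemma annihilator_series_mono:
  "m \<le> m' \<Longrightarrow> annihilator_series H m \<subseteq> annihilator_series H m'"
  by (rule lift_Suc_mono_le[of "annihilator_series H"]) (rule annihilator_series_Suc_mono)

text \<open>As \<open>x\<close> normalises \<open>H\<close>, \<open>lie x\<close> preserves each
  member of the series of \<open>H\<close>. For v in member m + 1, the vector (ad x)^(M - r) v lies
  in member m * M + r of the new series: bracketing it with \<open>H\<close> falls into the old
  member m, bracketing it with \<open>x\<close> into the case r - 1. At r = M this is v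
  itself.\<close>

lemma annihilator_series_insert:
  assumes H: "subspace H" and N: "annihilator_series H N = UNIV"
    and x: "\<And>h. h \<in> H \<Longrightarrow> lie h x \<in> H" and M: "\<And>v. (lie x ^^ M) v = 0"
  shows "annihilator_series (span (insert x H)) (N * M) = UNIV"
proof -
  let ?Z = "annihilator_series H" and ?Y = "annihilator_series (span (insert x H))"
  have stable: "lie x v \<in> ?Z m" if "v \<in> ?Z m" for v m
    using that
  proof (induction m arbitrary: v)
    case (Suc m)
    have "lie h (lie x v) \<in> ?Z m" if "h \<in> H" for h
      unfolding lie_leibniz[of h x v]
      using Suc that x subspace_add[OF subspace_annihilator_series] by simp
    then show ?case
      by simp
  qed (simp add: lie_zero_right)
  have stable_pow: "(lie x ^^ r) v \<in> ?Z m" if "v \<in> ?Z m" for v m r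
    by (induction r) (use that stable in auto)
  have Y_Suc: "w \<in> ?Y (Suc m)" if "\<And>h. h \<in> H \<Longrightarrow> lie h w \<in> ?Y m" "lie x w \<in> ?Y m" for w m
  proof -
    have "lie y w \<in> ?Y m" if "y \<in> span (insert x H)" for y
    proof -
      obtain k where "y - scale k x \<in> H"
        using \<open>y \<in> span (insert x H)\<close> H by (auto simp: span_breakdown_eq span_eq_iff[THEN iffD2])
      then have "lie (y - scale k x) w + scale k (lie x w) \<in> ?Y m"
        using \<open>\<And>h. h \<in> H \<Longrightarrow> lie h w \<in> ?Y m\<close> \<open>lie x w \<in> ?Y m\<close>
        by (intro subspace_add[OF subspace_annihilator_series]
            subspace_scale[OF subspace_annihilator_series]) auto
      then show ?thesis
        by (simp add: lie_diff_left lie_scale_left)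
    qed
    then show ?thesis
      by simp
  qed
  have "?Z m \<subseteq> ?Y (m * M)" for m
  proof (induction m)
    case (Suc m)
    show ?case
    proof
      fix v assume v: "v \<in> ?Z (Suc m)"
      have "(lie x ^^ (M - r)) v \<in> ?Y (m * M + r)" if "r \<le> M" for r
        using that
      proof (induction r)
        case 0
        then show ?case
          using M subspace_0[OF subspace_annihilator_series] by simp
      next
        case (Suc r)
        let ?w = "(lie x ^^ (M - Suc r)) v"
        have "lie h ?w \<in> ?Y (m * M + r)" if "h \<in> H" for h
        proof -
          have "lie h ?w \<in> ?Z m"
            using stable_pow[OF v, of "M - Suc r"] that by simp
          then show ?thesis
            using \<open>?Z m \<subseteq> ?Y (m * M)\<close> annihilator_series_mono[of "m * M" "m * M + r" "span (insert x H)"]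
            by auto
        qed
        moreover have "lie x ?w \<in> ?Y (m * M + r)"
        proof -
          have "M - r = Suc (M - Suc r)"
            using Suc.prems by simp
          then show ?thesis
            using Suc.IH Suc.prems by simp
        qed
        ultimately show ?case
          using Y_Suc[of ?w "m * M + r"] by simp
      qed
      from this[of M] show "v \<in> ?Y (Suc m * M)"
        by (simp add: add.commute)
    qed
  qed simp
  with N show ?thesis
    by blast
qed

text \<open>Take \<open>H\<close> of maximal dimension among the subalgebras of \<open>J\<close>
  that act nilpotently. Were it proper, an element of \<open>J\<close> outside \<open>H\<close> that
  normalises \<open>H\<close> could be adjoined by \<open>annihilator_series_insert\<close>.\<close>

lemma engel:
  assumes J: "subspace J" and closed: "\<And>x y. x \<in> J \<Longrightarrow> y \<in> J \<Longrightarrow> lie x y \<in> J"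
    and nil: "\<And>x. x \<in> J \<Longrightarrow> \<exists>m. \<forall>v. (lie x ^^ m) v = 0"
  shows "\<exists>N. annihilator_series J N = UNIV"
proof -
  define P where "P H \<longleftrightarrow> subspace H \<and> H \<subseteq> J \<and> (\<forall>x\<in>H. \<forall>y\<in>H. lie x y \<in> H) \<and>
      (\<exists>N. annihilator_series H N = UNIV)" for H
  have "annihilator_series {0} (Suc 0) = UNIV"
    by (simp add: lie_zero_left)
  then have P0: "P {0}"
    unfolding P_def using subspace_0[OF J] lie_zero_left subspace_single_0 by blast
  have "\<forall>H. P H \<longrightarrow> dim H < Suc dimension"
    by (simp add: dim_subset_UNIV less_Suc_eq_le)
  from ex_has_greatest_nat[of P, OF P0 this]
  obtain H where H: "P H" and max: "\<And>H'. P H' \<Longrightarrow> dim H' \<le> dim H"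
    by blast
  obtain N where N: "annihilator_series H N = UNIV"
    using H by (auto simp: P_def)
  have "J \<subseteq> H"
  proof (rule ccontr)
    assume "\<not> J \<subseteq> H"
    then have ex: "\<exists>m. \<not> J \<inter> annihilator_series H m \<subseteq> H"
      using N by (intro exI[of _ N]) auto
    \<comment> \<open>By minimality an element \<open>x\<close> of \<open>J\<close> in member
      \<open>m\<close> but outside \<open>H\<close> normalises \<open>H\<close>: each
      \<open>lie h x\<close> lies in \<open>J\<close> and in member m - 1, hence in
      \<open>H\<close>.\<close>
    define m where "m = (LEAST m. \<not> J \<inter> annihilator_series H m \<subseteq> H)"
    have m: "\<not> J \<inter> annihilator_series H m \<subseteq> H"
      unfolding m_def by (rule LeastI_ex[OF ex])
    have "m \<noteq> 0"
      using m H by (auto simp: P_def subspace_0)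
    then obtain m' where m': "m = Suc m'"
      using not0_implies_Suc by blast
    then have below: "J \<inter> annihilator_series H m' \<subseteq> H"
      using not_less_Least[of m' "\<lambda>m. \<not> J \<inter> annihilator_series H m \<subseteq> H"] by (simp add: m_def)
    obtain x where x: "x \<in> J" "x \<in> annihilator_series H m" "x \<notin> H"
      using m by blast
    have norm: "lie h x \<in> H" if "h \<in> H" for h
    proof -
      have "lie h x \<in> J"
        using that H x closed by (auto simp: P_def)
      moreover have "lie h x \<in> annihilator_series H m'"
        using x(2) that by (simp add: m')
      ultimately show ?thesis
        using below by blast
    qed
    obtain M where M: "\<And>v. (lie x ^^ M) v = 0"
      using nil[OF x(1)] by blast
    have sub: "subspace H"
      using H by (simp add: P_def)
    let ?H = "span (insert x H)"
    have decomp: "\<exists>k h. h \<in> H \<and> y = h + scale k x" if y: "y \<in> ?H" for y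
    proof -
      obtain k where "y - scale k x \<in> H"
        using y sub by (auto simp: span_breakdown_eq span_eq_iff[THEN iffD2])
      then show ?thesis
        by (intro exI[of _ k] exI[of _ "y - scale k x"]) simp
    qed
    have "lie y z \<in> ?H" if y: "y \<in> ?H" and z: "z \<in> ?H" for y z
    proof -
      obtain a h b g where h: "h \<in> H" "y = h + scale a x" and g: "g \<in> H" "z = g + scale b x"
        using decomp[OF y] decomp[OF z] by blast
      have "lie y z = lie h g + scale b (lie h x) - scale a (lie g x)"
        unfolding h g using lie_skew[of x g]
        by (simp add: lie_add_left lie_add_right lie_scale_left lie_scale_right lie_self)
      moreover have "\<dots> \<in> H"
        using H h g norm
        by (intro subspace_diff[OF sub] subspace_add[OF sub] subspace_scale[OF sub])
           (auto simp: P_def)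
      ultimately show ?thesis
        by (simp add: span_base)
    qed
    moreover have "?H \<subseteq> J"
      using H x by (intro span_minimal J) (auto simp: P_def)
    ultimately have "P ?H"
      unfolding P_def using annihilator_series_insert[OF sub N norm M] by blast
    then have "dim (insert x H) \<le> dim H"
      using max[of ?H] by simp
    moreover have "x \<notin> span H"
      using x(3) sub by (simp add: span_eq_iff[THEN iffD2])
    ultimately show False
      by (simp add: dim_insert)
  qed
  then have "J = H"
    using H by (auto simp: P_def)
  then show ?thesis
    using N by blast
qed

text \<open>The derived series of \<open>J\<close> descends along the annihilator series: a bracket
  [x, y] with x in \<open>J\<close> and y in member N - m lies in member N - m - 1. After
  \<open>N\<close> steps only 0 is left.\<close>

lemma solvable_if_ad_nilpotent:
  assumes J: "subspace J" and closed: "\<And>x y. x \<in> J \<Longrightarrow> y \<in> J \<Longrightarrow> lie x y \<in> J"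
    and nil: "\<And>x. x \<in> J \<Longrightarrow> \<exists>m. \<forall>v. (lie x ^^ m) v = 0"
  shows "solvable J"
proof -
  obtain N where N: "annihilator_series J N = UNIV"
    using engel[OF assms] by blast
  have "(derived ^^ m) J \<subseteq> J \<inter> annihilator_series J (N - m)" if "m \<le> N" for m
    using that
  proof (induction m)
    case 0
    then show ?case
      using N by simp
  next
    case (Suc m)
    then have IH: "(derived ^^ m) J \<subseteq> J \<inter> annihilator_series J (Suc (N - Suc m))"
      by (simp add: Suc_diff_Suc)
    have "{lie x y |x y. x \<in> (derived ^^ m) J \<and> y \<in> (derived ^^ m) J}
        \<subseteq> J \<inter> annihilator_series J (N - Suc m)"
      using IH closed by fastforce
    then show ?case
      by (simp add: derived_def[of "(derived ^^ m) J"] span_minimal subspace_inter J subspace_annihilator_series)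
  qed
  from this[of N] have "(derived ^^ N) J \<subseteq> {0}"
    by auto
  moreover have "0 \<in> (derived ^^ N) J"
    using subspace_0[OF J] by (cases N) (auto simp: derived_def span_zero)
  ultimately show ?thesis
    unfolding solvable_def by blast
qed

section \<open>The Killing form and its radical\<close>

definition killing :: "'g \<Rightarrow> 'g \<Rightarrow> complex" where
  "killing x y = lin_trace (\<lambda>v. lie x (lie y v))"

lemma killing_sym: "killing x y = killing y x"
  unfolding killing_def by (rule trace_comm[OF lie_linear_right lie_linear_right])

lemma killing_functional_left: "functional (\<lambda>x. killing x y)"
  unfolding killing_def
  by (rule functionalI) (simp_all add: lie_add_left lie_scale_left trace_add trace_scale)

lemma killing_functional_right: "functional (\<lambda>y. killing x y)"
  using killing_functional_left[of x] by (simp add: killing_sym)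

lemma killing_invariant: "killing (lie x y) z = - killing y (lie x z)"
proof -
  have "lin_trace (\<lambda>v. lie x (lie y (lie z v))) = lin_trace (\<lambda>v. lie y (lie z (lie x v)))"
    by (rule trace_comm[OF lie_linear_right linear_map_comp[OF lie_linear_right lie_linear_right]])
  then show ?thesis
    by (simp add: killing_def lie_lie_left lie_diff_right trace_diff)
qed

text \<open>The radical \<open>I\<close> is an ideal, and every \<open>x\<close> in
  \<open>derived I\<close> is ad-nilpotent, since tr(D ad x) = 0 for the conjugate derivation
  \<open>D\<close> of \<open>lie x\<close>. So \<open>derived I\<close>, and with it
  \<open>I\<close>, is solvable, and semisimplicity gives I = 0.\<close>

theorem killing_nondegenerate:
  assumes "semisimple" and "\<And>y. killing x y = 0"
  shows "x = 0"
proof -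
  define I where "I = {x. \<forall>y. killing x y = 0}"
  have I: "subspace I"
    unfolding subspace_def I_def
    by (simp add: linear_map_add[OF killing_functional_left]
        linear_map_scale[OF killing_functional_left] linear_map_zero[OF killing_functional_left])
  have ideal: "lie y x \<in> I" if "x \<in> I" for x y
    using that by (simp add: I_def killing_invariant)
  have sub: "subspace (derived I)"
    by (simp add: derived_def)
  have derived_le: "derived I \<subseteq> I"
    unfolding derived_def using I ideal by (intro span_minimal) auto
  have "solvable (derived I)"
  proof (rule solvable_if_ad_nilpotent[OF sub])
    show "lie x y \<in> derived I" if "x \<in> derived I" "y \<in> derived I" for x y
      using that derived_le unfolding derived_def by (intro span_base) blast
  next
    fix x assume x: "x \<in> derived I"
    obtain D where D: "derivation D"
      and nil: "lin_trace (\<lambda>v. D (lie x v)) = 0 \<Longrightarrow> \<exists>m. \<forall>v. (lie x ^^ m) v = 0"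
      using conjugate_derivation[OF derivation_lie[of x]] by blast
    have linD: "lin D" and derD: "\<And>v w. D (lie v w) = lie (D v) w + lie v (D w)"
      using D by (auto simp: derivation_def)
    have "subspace {x. lin_trace (\<lambda>v. D (lie x v)) = 0}"
      unfolding subspace_def
      by (simp add: lie_zero_left lie_add_left lie_scale_left linear_map_zero[OF linD]
          linear_map_add[OF linD] linear_map_scale[OF linD] trace_add trace_scale trace_zero)
    \<comment> \<open>Cyclicity of the trace gives tr(D ad[a, b]) = tr([D, ad a] ad b), and
      [D, ad a] = ad(D a) for a derivation. What remains is a Killing value with \<open>b\<close> in
      the radical.\<close>
    moreover have "lin_trace (\<lambda>v. D (lie (lie a b) v)) = 0" if b: "b \<in> I" for a b
    proof -
      have "lin_trace (\<lambda>v. D (lie b (lie a v))) = lin_trace (\<lambda>v. lie a (D (lie b v)))"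
        by (rule trace_comm[OF linear_map_comp[OF linD lie_linear_right] lie_linear_right])
      then have "lin_trace (\<lambda>v. D (lie (lie a b) v)) = killing (D a) b"
        by (simp add: lie_lie_left linear_map_diff[OF linD] trace_diff derD[of a] trace_add killing_def)
      also have "\<dots> = 0"
        using b by (simp add: I_def killing_sym[of "D a"])
      finally show ?thesis .
    qed
    ultimately have "derived I \<subseteq> {x. lin_trace (\<lambda>v. D (lie x v)) = 0}"
      unfolding derived_def by (intro span_minimal) auto
    then show "\<exists>m. \<forall>v. (lie x ^^ m) v = 0"
      using nil x by blast
  qed
  then have "solvable I"
    unfolding solvable_def using funpow_swap1[of derived _ I]
    by (metis funpow.simps(2) o_apply)
  then have "I = {0}"
    using assms(1) I ideal unfolding semisimple_def lie_ideal_def by blast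
  then show ?thesis
    using assms(2) by (auto simp: I_def)
qed

end


section \<open>Alternating sums and shuffles\<close>

lemma strict_mono_on_image_unique:
  fixes f g :: "nat \<Rightarrow> nat"
  assumes "strict_mono_on {a..<b} f" "strict_mono_on {a..<b} g"
    and "f ` {a..<b} = g ` {a..<b}" "i \<in> {a..<b}"
  shows "f i = g i"
proof -
  have sorted: "sorted_wrt (<) (map h [a..<b])" if "strict_mono_on {a..<b} h" for h :: "nat \<Rightarrow> nat"
    unfolding sorted_wrt_map
    by (rule sorted_wrt_mono_rel[of _ "(<)"])
       (use that in \<open>auto simp: strict_mono_on_def sorted_wrt_upt\<close>)
  have "map f [a..<b] = map g [a..<b]"
    by (rule strict_sorted_equal[OF sorted[OF assms(2)] sorted[OF assms(1)]]) (simp add: assms(3))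
  then show ?thesis
    using assms(4) by simp
qed

lemma ex_strict_mono_on_image:
  fixes A :: "nat set"
  assumes "finite A" "card A = b - a"
  obtains f where "strict_mono_on {a..<b} f" "f ` {a..<b} = A"
proof -
  define f where "f i = sorted_list_of_set A ! (i - a)" for i
  have len: "length (sorted_list_of_set A) = b - a"
    using assms by simp
  have "strict_mono_on {a..<b} f"
    unfolding strict_mono_on_def f_def
    using sorted_wrt_nth_less[OF strict_sorted_list_of_set[of A]] len by auto
  moreover have "f ` {a..<b} = A"
  proof -
    have "f ` {a..<b} = (!) (sorted_list_of_set A) ` {0..<length (sorted_list_of_set A)}"
    proof -
      have "(\<lambda>i. i - a) ` {a..<b} = {0..<b - a}"
      proof (rule Set.set_eqI)
        show "x \<in> (\<lambda>i. i - a) ` {a..<b} \<longleftrightarrow> x \<in> {0..<b - a}" for x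
          by (auto intro!: image_eqI[of _ _ "x + a"])
      qed
      then show ?thesis
        unfolding f_def len by (metis image_image)
    qed
    also have "\<dots> = set (sorted_list_of_set A)"
      by (metis list.set_map map_nth set_upt)
    finally show ?thesis
      using assms(1) by simp
  qed
  ultimately show ?thesis
    using that by blast
qed

section \<open>Shuffles as coset representatives\<close>

text \<open>The Young subgroup S_p x S_q; its elements map the upper block to itself as the
  complement of the lower one.\<close>

definition young :: "nat \<Rightarrow> nat \<Rightarrow> (nat \<Rightarrow> nat) set" where
  "young p q = {\<tau>. \<tau> permutes {..<p + q} \<and> \<tau> ` {..<p} = {..<p}}"

lemma permutes_image_upper:
  fixes \<sigma> :: "nat \<Rightarrow> nat"
  assumes "\<sigma> permutes {..<p + q}"
  shows "\<sigma> ` {p..<p + q} = {..<p + q} - \<sigma> ` {..<p}"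
proof -
  have "{p..<p + q} = {..<p + q} - {..<p}"
    by auto
  then show ?thesis
    using permutes_image[OF assms] image_set_diff[OF permutes_inj[OF assms]] by metis
qed

text \<open>The coset of \<open>\<sigma>\<close> modulo the Young subgroup is determined by the
  image of \<open>{..<p}\<close>; the one shuffle in it enumerates this image and its complement
  increasingly.\<close>

lemma bij_betw_shuffles_young:
  "bij_betw (\<lambda>(s, t). s \<circ> t) (shuffles p q \<times> young p q) {\<sigma>. \<sigma> permutes {..<p + q}}"
  unfolding bij_betw_def
proof
  show "inj_on (\<lambda>(s, t). s \<circ> t) (shuffles p q \<times> young p q)"
  proof (rule inj_onI, clarsimp)
    fix s t s' t'
    assume s: "s \<in> shuffles p q" and s': "s' \<in> shuffles p q"
      and t: "t \<in> young p q" and t': "t' \<in> young p q" and eq: "s \<circ> t = s' \<circ> t'"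
    have "s ` {..<p} = (s \<circ> t) ` {..<p}"
      using t by (simp only: young_def mem_Collect_eq image_comp[symmetric])
    also have "\<dots> = s' ` {..<p}"
      unfolding eq using t' by (simp only: young_def mem_Collect_eq image_comp[symmetric])
    finally have lower: "s ` {..<p} = s' ` {..<p}" .
    have perm: "s permutes {..<p + q}" "s' permutes {..<p + q}"
      using s s' by (auto simp: shuffles_def)
    have upper: "s ` {p..<p + q} = s' ` {p..<p + q}"
      using perm lower by (simp add: permutes_image_upper)
    have "s i = s' i" for i
    proof -
      consider "i < p" | "p \<le> i" "i < p + q" | "p + q \<le> i"
        by linarith
      then show ?thesis
      proof cases
        case 1
        then show ?thesis
          using s s' lower strict_mono_on_image_unique[of 0 p s s' i]
          by (auto simp: shuffles_def atLeast0LessThan)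
      next
        case 2
        then show ?thesis
          using s s' upper strict_mono_on_image_unique[of p "p + q" s s' i]
          by (auto simp: shuffles_def)
      next
        case 3
        then show ?thesis
          using perm by (simp add: permutes_not_in)
      qed
    qed
    then have "s = s'"
      by blast
    moreover have "t = t'"
      using eq inj_eq[OF permutes_inj[OF perm(1)]] unfolding \<open>s = s'\<close>[symmetric]
      by (auto simp: fun_eq_iff)
    ultimately show "s = s' \<and> t = t'"
      by blast
  qed
  show "(\<lambda>(s, t). s \<circ> t) ` (shuffles p q \<times> young p q) = {\<sigma>. \<sigma> permutes {..<p + q}}"
  proof (intro equalityI subsetI)
    fix \<sigma> assume "\<sigma> \<in> (\<lambda>(s, t). s \<circ> t) ` (shuffles p q \<times> young p q)"
    then show "\<sigma> \<in> {\<sigma>. \<sigma> permutes {..<p + q}}"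
      by (auto simp: shuffles_def young_def permutes_compose)
  next
    fix \<sigma> assume "\<sigma> \<in> {\<sigma>. \<sigma> permutes {..<p + q}}"
    then have \<sigma>: "\<sigma> permutes {..<p + q}"
      by simp
    have "card (\<sigma> ` {..<p}) = p"
      using card_image[OF permutes_inj_on[OF \<sigma>]] by simp
    then obtain f where f: "strict_mono_on {0..<p} f" "f ` {0..<p} = \<sigma> ` {..<p}"
      using ex_strict_mono_on_image[of "\<sigma> ` {..<p}" p 0] by auto
    have "card (\<sigma> ` {p..<p + q}) = q"
      using card_image[OF permutes_inj_on[OF \<sigma>]] by simp
    then obtain g where g: "strict_mono_on {p..<p + q} g" "g ` {p..<p + q} = \<sigma> ` {p..<p + q}"
      using ex_strict_mono_on_image[of "\<sigma> ` {p..<p + q}" "p + q" p] by auto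
    define s where "s i = (if i < p then f i else if i < p + q then g i else i)" for i
    have s_lower: "s ` {..<p} = \<sigma> ` {..<p}"
      using f(2) by (simp add: s_def atLeast0LessThan)
    have s_upper: "s ` {p..<p + q} = \<sigma> ` {p..<p + q}"
      using g(2) by (simp add: s_def)
    have "s ` {..<p + q} = \<sigma> ` {..<p + q}"
    proof -
      have "{..<p + q} = {..<p} \<union> {p..<p + q}"
        by auto
      then show ?thesis
        by (simp only: image_Un s_lower s_upper)
    qed
    then have surj: "s ` {..<p + q} = {..<p + q}"
      by (simp add: permutes_image[OF \<sigma>])
    then have "bij_betw s {..<p + q} {..<p + q}"
      by (simp add: bij_betw_def eq_card_imp_inj_on)
    then have s_perm: "s permutes {..<p + q}"
      by (rule bij_imp_permutes) (simp add: s_def)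
    moreover have "strict_mono_on {..<p} s" "strict_mono_on {p..<p + q} s"
      using f(1) g(1) by (auto simp: strict_mono_on_def s_def)
    ultimately have s: "s \<in> shuffles p q"
      by (simp add: shuffles_def)
    have "(inv_into UNIV s \<circ> \<sigma>) ` {..<p} = {..<p}"
      using permutes_inj[OF s_perm] by (simp only: image_comp[symmetric] s_lower[symmetric] image_inv_f_f)
    then have "inv_into UNIV s \<circ> \<sigma> \<in> young p q"
      by (simp add: young_def permutes_compose permutes_inv \<sigma> s_perm)
    moreover have "\<sigma> = s \<circ> (inv_into UNIV s \<circ> \<sigma>)"
      using permutes_surj[OF s_perm] by (simp add: fun_eq_iff surj_f_inv_f)
    ultimately show "\<sigma> \<in> (\<lambda>(s, t). s \<circ> t) ` (shuffles p q \<times> young p q)"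
      using s by (intro image_eqI[of _ _ "(s, inv_into UNIV s \<circ> \<sigma>)"]) auto
  qed
qed

text \<open>The shuffle sum is repeated once for each \<open>t\<close> rather than multiplied by the
  order of the Young subgroup, which makes sense in any commutative monoid.\<close>

lemma sum_permutations_eq_shuffles:
  fixes g :: "(nat \<Rightarrow> nat) \<Rightarrow> 'a::comm_monoid_add"
  assumes "\<And>s t. s \<in> shuffles p q \<Longrightarrow> t \<in> young p q \<Longrightarrow> g (s \<circ> t) = g s"
  shows "(\<Sum>\<sigma> | \<sigma> permutes {..<p + q}. g \<sigma>) = (\<Sum>t\<in>young p q. \<Sum>s\<in>shuffles p q. g s)"
proof -
  have "(\<Sum>\<sigma> | \<sigma> permutes {..<p + q}. g \<sigma>) = (\<Sum>(s, t)\<in>shuffles p q \<times> young p q. g (s \<circ> t))"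
    using sum.reindex_bij_betw[OF bij_betw_shuffles_young, of g] by (simp add: case_prod_unfold)
  also have "\<dots> = (\<Sum>(s, t)\<in>shuffles p q \<times> young p q. g s)"
    by (rule sum.cong) (auto simp: assms)
  also have "\<dots> = (\<Sum>s\<in>shuffles p q. \<Sum>t\<in>young p q. g s)"
    by (rule sum.cartesian_product[symmetric])
  finally show ?thesis
    by (subst sum.swap)
qed

text \<open>A permutation preserving both blocks is a product of one that moves only the lower block
  and one that moves only the upper, and each of these is a product of transpositions within its
  block.\<close>

lemma young_invariant:
  fixes g :: "(nat \<Rightarrow> nat) \<Rightarrow> 'a"
  assumes "\<And>\<sigma> a b. \<sigma> permutes {..<p + q} \<Longrightarrow> a \<noteq> b \<Longrightarrow>
      (a < p \<and> b < p) \<or> (p \<le> a \<and> a < p + q \<and> p \<le> b \<and> b < p + q) \<Longrightarrow>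
      g (\<sigma> \<circ> Transposition.transpose a b) = g \<sigma>"
    and \<sigma>: "\<sigma> permutes {..<p + q}" and t: "t \<in> young p q"
  shows "g (\<sigma> \<circ> t) = g \<sigma>"
proof -
  \<comment> \<open>Quantified over \<open>\<sigma>\<close> because the induction peels a
    transposition off the left of \<open>t\<close> and absorbs it into
    \<open>\<sigma>\<close>.\<close>
  have gen: "\<forall>\<sigma>. \<sigma> permutes {..<p + q} \<longrightarrow> g (\<sigma> \<circ> t) = g \<sigma>"
    if "t permutes S" "S = {..<p} \<or> S = {p..<p + q}" for t S
  proof -
    have fin: "finite S"
      using that(2) by auto
    show ?thesis
      using that(1) fin
    proof (induction rule: permutes_induct)
      case id
      then show ?case
        by simp
    next
      case (swap a b r)
      have ab: "(a < p \<and> b < p) \<or> (p \<le> a \<and> a < p + q \<and> p \<le> b \<and> b < p + q)"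
        using swap.hyps that(2) by auto
      show ?case
      proof (intro allI impI)
        fix \<sigma> :: "nat \<Rightarrow> nat" assume \<sigma>: "\<sigma> permutes {..<p + q}"
        have "\<sigma> \<circ> Transposition.transpose a b permutes {..<p + q}"
          using ab by (intro permutes_compose \<sigma> permutes_swap_id) auto
        then have "g ((\<sigma> \<circ> Transposition.transpose a b) \<circ> r) = g (\<sigma> \<circ> Transposition.transpose a b)"
          using swap.IH by blast
        also have "\<dots> = g \<sigma>"
          by (rule assms(1)[OF \<sigma> swap.hyps(3) ab])
        finally show "g (\<sigma> \<circ> (Transposition.transpose a b \<circ> r)) = g \<sigma>"
          by (simp only: o_assoc)
      qed
    qed
  qed
  have tp: "t permutes {..<p + q}" and lower: "t ` {..<p} = {..<p}"
    using t by (auto simp: young_def)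
  have upper: "t ` {p..<p + q} = {p..<p + q}"
    using permutes_image_upper[OF tp] lower by auto
  define t1 where "t1 i = (if i < p then t i else i)" for i
  define t2 where "t2 i = (if i < p then i else t i)" for i
  have inj: "inj_on t S" for S
    by (rule permutes_inj_on[OF tp])
  have "bij_betw t1 {..<p} {..<p} \<longleftrightarrow> bij_betw t {..<p} {..<p}"
    by (rule bij_betw_cong) (simp add: t1_def)
  then have "bij_betw t1 {..<p} {..<p}"
    using inj lower by (simp add: bij_betw_def)
  then have t1: "t1 permutes {..<p}"
    by (rule bij_imp_permutes) (simp add: t1_def)
  have "bij_betw t2 {p..<p + q} {p..<p + q} \<longleftrightarrow> bij_betw t {p..<p + q} {p..<p + q}"
    by (rule bij_betw_cong) (simp add: t2_def)
  then have "bij_betw t2 {p..<p + q} {p..<p + q}"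
    using inj upper by (simp add: bij_betw_def)
  then have t2: "t2 permutes {p..<p + q}"
  proof (rule bij_imp_permutes)
    fix i assume "i \<notin> {p..<p + q}"
    then show "t2 i = i"
      using permutes_not_in[OF tp, of i] by (simp add: t2_def)
  qed
  have ge: "p \<le> t i" if i: "p \<le> i" for i
  proof (cases "i < p + q")
    case True
    then have "t i \<in> t ` {p..<p + q}"
      using i by simp
    then show ?thesis
      unfolding upper by simp
  next
    case False
    then show ?thesis
      using permutes_not_in[OF tp, of i] i by simp
  qed
  have t12: "t = t1 \<circ> t2"
  proof
    show "t i = (t1 \<circ> t2) i" for i
      using ge[of i] by (cases "i < p") (simp_all add: t1_def t2_def)
  qed
  have "\<sigma> \<circ> t1 permutes {..<p + q}"
    by (intro permutes_compose \<sigma> permutes_subset[OF t1]) auto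
  then have "g ((\<sigma> \<circ> t1) \<circ> t2) = g (\<sigma> \<circ> t1)"
    using gen[OF t2] by blast
  also have "\<dots> = g \<sigma>"
    using gen[OF t1] \<sigma> by blast
  finally show ?thesis
    by (simp only: t12 o_assoc)
qed

lemma permute_list_transpose:
  assumes "i < length X" "j < length X"
  shows "permute_list (Transposition.transpose i j) X = X[i := X ! j, j := X ! i]"
  by (rule nth_equalityI)
     (use assms in \<open>auto simp: permute_list_def nth_list_update Transposition.transpose_def\<close>)

section \<open>Antisymmetrisation over the arguments\<close>

definition alternation :: "nat \<Rightarrow> ('a list \<Rightarrow> 'b::comm_ring_1) \<Rightarrow> 'a list \<Rightarrow> 'b" where
  "alternation N f X = (\<Sum>\<sigma> | \<sigma> permutes {..<N}. of_int (sign \<sigma>) * f (permute_list \<sigma> X))"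

lemma alternation_cong:
  assumes "length X = N" "\<And>X. length X = N \<Longrightarrow> f X = g X"
  shows "alternation N f X = alternation N g X"
  unfolding alternation_def using assms by (intro sum.cong) auto

lemma alternation_add: "alternation N (\<lambda>X. f X + g X) X = alternation N f X + alternation N g X"
  by (simp add: alternation_def sum.distrib distrib_left)

lemma alternation_neg: "alternation N (\<lambda>X. - f X) X = - alternation N f X"
  by (simp add: alternation_def sum_negf)

lemma alternation_scale: "alternation N (\<lambda>X. c * f X) X = c * alternation N f X"
  by (simp add: alternation_def sum_distrib_left mult_ac)

lemma alternation_sum:
  "alternation N (\<lambda>X. \<Sum>j\<in>J. f j X) X = (\<Sum>j\<in>J. alternation N (f j) X)"
  unfolding alternation_def by (subst sum.swap) (simp add: sum_distrib_left)

text \<open>Reindexing by \<open>\<sigma> \<circ> t\<close> applies \<open>permute_list t\<close>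
  after \<open>permute_list \<sigma>\<close>; the sign of \<open>t\<close> changes sides because its
  square is 1.\<close>

lemma alternation_permute:
  assumes X: "length X = N" and t: "t permutes {..<N}"
  shows "alternation N (\<lambda>X. f (permute_list t X)) X = of_int (sign t) * alternation N f X"
proof -
  have "alternation N f X
      = (\<Sum>\<sigma> | \<sigma> permutes {..<N}. of_int (sign (\<sigma> \<circ> t)) * f (permute_list (\<sigma> \<circ> t) X))"
    unfolding alternation_def by (rule sum_permutations_compose_right[OF t])
  also have "\<dots> = (\<Sum>\<sigma> | \<sigma> permutes {..<N}. of_int (sign t) *
      (of_int (sign \<sigma>) * f (permute_list t (permute_list \<sigma> X))))"
  proof (rule sum.cong[OF refl])
    fix \<sigma> :: "nat \<Rightarrow> nat" assume "\<sigma> \<in> {\<sigma>. \<sigma> permutes {..<N}}"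
    then have "permutation \<sigma>" "permutation t"
      using t permutes_imp_permutation by auto
    then show "of_int (sign (\<sigma> \<circ> t)) * f (permute_list (\<sigma> \<circ> t) X)
        = of_int (sign t) * (of_int (sign \<sigma>) * f (permute_list t (permute_list \<sigma> X)))"
      using t X by (simp add: sign_compose permute_list_compose)
  qed
  also have "\<dots> = of_int (sign t) * alternation N (\<lambda>X. f (permute_list t X)) X"
    by (simp add: alternation_def sum_distrib_left)
  finally have "of_int (sign t) * alternation N f X
      = of_int (sign t * sign t) * alternation N (\<lambda>X. f (permute_list t X)) X"
    by (simp only: of_int_mult mult.assoc)
  then show ?thesis
    by simp
qed

lemma alternation_transpose:
  assumes "length X = N" "i < N" "j < N" "i \<noteq> j"
  shows "alternation N (\<lambda>X. f (permute_list (Transposition.transpose i j) X)) X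
    = - alternation N f X"
  using alternation_permute[OF assms(1) permutes_swap_id[of i "{..<N}" j], of f] assms
  by (simp add: sign_swap_id)

text \<open>Meant for disjoint intervals of length \<open>m\<close> starting at \<open>a\<close> and
  \<open>b\<close>. With a = 1, b = n and n = m + 1 it trades all but the first of the leading n
  arguments for the last m ones.\<close>

definition block_swap :: "nat \<Rightarrow> nat \<Rightarrow> nat \<Rightarrow> nat \<Rightarrow> nat" where
  "block_swap a b m i =
    (if a \<le> i \<and> i < a + m then i + b - a else if b \<le> i \<and> i < b + m then i + a - b else i)"

lemma block_swap_Suc:
  assumes "a + Suc m \<le> b"
  shows "block_swap a b (Suc m) = block_swap a b m \<circ> Transposition.transpose (a + m) (b + m)"
proof
  fix i
  consider "i = a + m" | "i = b + m" | "i \<noteq> a + m" "i \<noteq> b + m"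
    by blast
  then show "block_swap a b (Suc m) i
      = (block_swap a b m \<circ> Transposition.transpose (a + m) (b + m)) i"
    by cases (use assms in \<open>auto simp: block_swap_def\<close>)
qed

text \<open>Each of the \<open>m\<close> places contributes one transposition. For odd
  \<open>m\<close> the swap is odd, which supplies the decisive sign in
  \<open>alternation_B_F_F\<close>.\<close>

lemma block_swap_permutes:
  assumes "a + m \<le> b" "b + m \<le> N"
  shows "block_swap a b m permutes {..<N} \<and> sign (block_swap a b m) = (- 1) ^ m"
  using assms
proof (induction m)
  case 0
  have "block_swap a b 0 = id"
    by (auto simp: block_swap_def)
  then show ?case
    by (simp only: permutes_id sign_id power_0 simp_thms)
next
  case (Suc m)
  then have IH: "block_swap a b m permutes {..<N}" "sign (block_swap a b m) = (- 1) ^ m"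
    by simp_all
  have t: "Transposition.transpose (a + m) (b + m) permutes {..<N}"
    using Suc.prems by (intro permutes_swap_id) auto
  have "permutation (block_swap a b m)" "permutation (Transposition.transpose (a + m) (b + m))"
    using IH(1) t permutes_imp_permutation by blast+
  then have "sign (block_swap a b (Suc m)) = (- 1) ^ m * (- 1)"
    unfolding block_swap_Suc[OF Suc.prems(1)] sign_compose[OF \<open>permutation (block_swap a b m)\<close>
        \<open>permutation (Transposition.transpose (a + m) (b + m))\<close>]
    using IH(2) Suc.prems by (simp add: sign_swap_id)
  moreover have "block_swap a b (Suc m) permutes {..<N}"
    unfolding block_swap_Suc[OF Suc.prems(1)] by (rule permutes_compose[OF t IH(1)])
  ultimately show ?case
    by simp
qed

text \<open>Trading an argument of one factor for one of the other is an update in each factor, the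
  form of the summands that \<open>lie_F_exchange\<close> produces.\<close>

lemma take_drop_transpose_across:
  assumes "length X = n + m" "i < n" "j < m"
  shows "take n (permute_list (Transposition.transpose i (n + j)) X) = (take n X)[i := drop n X ! j]"
    and "drop n (permute_list (Transposition.transpose i (n + j)) X) = (drop n X)[j := take n X ! i]"
  using assms
  by (simp_all add: permute_list_transpose take_update_swap drop_update_swap list_update_beyond)

lemma take_drop_transpose_within:
  assumes "length X = n + m" "i < n" "j < n"
  shows "take n (permute_list (Transposition.transpose i j) X) = (take n X)[i := X ! j, j := X ! i]"
    and "drop n (permute_list (Transposition.transpose i j) X) = drop n X"
  using assms
  by (simp_all add: permute_list_transpose take_update_swap)

lemma take_drop_block_swap:
  assumes "length X = n + m" "n = Suc m"
  shows "take n (permute_list (block_swap 1 n m) X) = X ! 0 # drop n X"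
    and "drop n (permute_list (block_swap 1 n m) X) = tl (take n X)"
proof -
  show "take n (permute_list (block_swap 1 n m) X) = X ! 0 # drop n X"
  proof (rule nth_equalityI)
    fix i assume "i < length (take n (permute_list (block_swap 1 n m) X))"
    then show "take n (permute_list (block_swap 1 n m) X) ! i = (X ! 0 # drop n X) ! i"
      using assms by (cases i) (auto simp: permute_list_def block_swap_def add_ac)
  qed (use assms in simp)
  show "drop n (permute_list (block_swap 1 n m) X) = tl (take n X)"
  proof (rule nth_equalityI)
    fix i assume "i < length (drop n (permute_list (block_swap 1 n m) X))"
    then show "drop n (permute_list (block_swap 1 n m) X) ! i = tl (take n X) ! i"
      using assms by (simp add: permute_list_def block_swap_def nth_tl del: upt_Suc)
  qed (use assms in simp)
qed


section \<open>Invariant cyclic cochains\<close>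

context fd_lie_algebra
begin

lemma skew_cochain_transpose:
  assumes "F \<in> skew_cochains scale n" "length X = n" "i < n" "j < n" "i \<noteq> j"
  shows "F (permute_list (Transposition.transpose i j) X) = - F X"
proof -
  have "Transposition.transpose i j permutes {..<n}"
    using assms by (intro permutes_swap_id) auto
  then have "F (permute_list (Transposition.transpose i j) X)
      = scale (of_int (sign (Transposition.transpose i j))) (F X)"
    using assms(1,2) unfolding skew_cochains_def by blast
  then show ?thesis
    using assms(5) by (simp add: sign_swap_id)
qed

text \<open>\<open>z\<close> travels to the end past one entry of \<open>ys\<close> at a time, each
  adjacent transposition costing a sign.\<close>

lemma skew_cochain_rotate:
  assumes F: "F \<in> skew_cochains scale n" and "length xs + 1 + length ys = n"
  shows "F (xs @ z # ys) = scale ((- 1) ^ length ys) (F (xs @ ys @ [z]))"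
  using assms(2)
proof (induction ys arbitrary: xs)
  case (Cons a ys)
  let ?X = "xs @ a # z # ys" and ?t = "Transposition.transpose (length xs) (Suc (length xs))"
  have "permute_list ?t ?X = xs @ z # a # ys"
    by (subst permute_list_transpose) (simp_all add: nth_append list_update_append)
  then have "F (xs @ z # a # ys) = - F ((xs @ [a]) @ z # ys)"
    using skew_cochain_transpose[OF F, of ?X "length xs" "Suc (length xs)"] Cons.prems by simp
  also have "\<dots> = - scale ((- 1) ^ length ys) (F ((xs @ [a]) @ ys @ [z]))"
    using Cons.prems by (subst Cons.IH) simp_all
  finally show ?case
    by simp
qed simp

text \<open>For even \<open>n\<close> the cyclic rule brings \<open>z\<close> to the front without a
  sign; carrying it back over the n - 1 entries of \<open>Ys\<close>, an odd number, produces the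
  minus.\<close>

lemma quadratic_if_cyclic:
  assumes B: "functional (\<lambda>x. B x y)" "\<And>x y. B x y = B y x"
    and F: "F \<in> skew_cochains scale n" "cyclic_cochain B n F" and n: "even n"
    and Ys: "length Ys + 1 = n"
  shows "B (F (Ys @ [y])) z = - B y (F (Ys @ [z]))"
proof -
  have "hat B F (Ys @ [y, z]) = (- 1) ^ n * hat B F (last (Ys @ [y, z]) # butlast (Ys @ [y, z]))"
    using F(2) Ys unfolding cyclic_cochain_def by simp
  then have "B (F (Ys @ [y])) z = B (F (z # Ys)) y"
    using n by (simp add: hat_def butlast_append)
  also have "F (z # Ys) = - F (Ys @ [z])"
    using skew_cochain_rotate[OF F(1), of "[]" Ys z] Ys n by (cases "even (length Ys)") auto
  finally show ?thesis
    by (simp only: linear_map_neg[OF B(1)] B(2)[of y])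
qed

end

section \<open>Invariant cochains for which \<open>B\<close> is invariant\<close>

text \<open>Cyclicity enters in the form \<open>F_quadratic\<close>, which
  \<open>quadratic_if_cyclic\<close> draws from it.\<close>

locale quadratic_cochain = fd_lie_algebra scale Basis lie
  for scale :: "complex \<Rightarrow> 'g::ab_group_add \<Rightarrow> 'g" and Basis :: "'g set"
    and lie :: "'g \<Rightarrow> 'g \<Rightarrow> 'g" +
  fixes B :: "'g \<Rightarrow> 'g \<Rightarrow> complex" and n :: nat and F :: "'g list \<Rightarrow> 'g"
  assumes B_left: "functional (\<lambda>x. B x y)"
    and B_right: "functional (\<lambda>y. B x y)"
    and B_sym: "B x y = B y x"
    and B_nondegenerate: "(\<And>y. B x y = 0) \<Longrightarrow> x = 0"
    and B_invariant: "B (lie x y) z = - B y (lie x z)"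
    and F_cochain: "F \<in> skew_cochains scale n"
    and F_invariant: "invariant_cochain lie n F"
    and F_quadratic: "length Ys + 1 = n \<Longrightarrow> B (F (Ys @ [Y])) Z = - B Y (F (Ys @ [Z]))"
begin

lemma F_linear:
  assumes "length X = n" "j < n"
  shows "lin (\<lambda>x. F (X[j := x]))"
proof -
  have "length (take j X) + 1 + length (drop (Suc j) X) = n"
    using assms by simp
  then have "lin (\<lambda>x. F (take j X @ x # drop (Suc j) X))"
    using F_cochain unfolding skew_cochains_def by blast
  then show ?thesis
    using assms by (simp add: upd_conv_take_nth_drop)
qed

lemmas F_transpose = skew_cochain_transpose[OF F_cochain]

lemma F_swap:
  assumes "length X = n" "i < n" "j < n" "i \<noteq> j"
  shows "F (X[i := a, j := b]) = - F (X[i := b, j := a])"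
proof -
  have "permute_list (Transposition.transpose i j) (X[i := b, j := a]) = X[i := a, j := b]"
    using assms by (subst permute_list_transpose) (auto intro!: nth_equalityI simp: nth_list_update)
  then show ?thesis
    using F_transpose[of "X[i := b, j := a]" i j] assms by simp
qed

text \<open>\<open>F_quadratic\<close> is the case of the last argument; one swap brings position
  \<open>j\<close> there, with the same sign on both sides. Together with skewness of
  \<open>F\<close>, this makes \<open>hat B F\<close> alternating in all n + 1 arguments.\<close>

lemma B_F_skew:
  assumes X: "length X = n" "j < n"
  shows "B (F (X[j := a])) b = - B (F (X[j := b])) a"
proof -
  have last: "B (F (X[n - 1 := a])) b = - B (F (X[n - 1 := b])) a"
    if X: "length X = n" for X a b
  proof -
    obtain Ys y where Ys: "X = Ys @ [y]"
      using X assms(2) by (cases X rule: rev_cases) auto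
    have n: "n = Suc (length Ys)"
      using X by (simp add: Ys)
    show ?thesis
      using F_quadratic[of Ys a b] B_sym[of a "F (Ys @ [b])"] by (simp add: Ys n)
  qed
  show ?thesis
  proof (cases "j = n - 1")
    case True
    show ?thesis
      unfolding True by (rule last[OF X(1)])
  next
    case False
    define z where "z = X ! (n - 1)"
    have "F (X[j := a]) = - F ((X[j := z])[n - 1 := a])" for a
    proof -
      have eq: "X[j := a] = X[j := a, n - 1 := z]"
        using X False by (intro nth_equalityI) (auto simp: z_def nth_list_update)
      show ?thesis
        by (subst eq, rule F_swap) (use X False in auto)
    qed
    then show ?thesis
      using last[of "X[j := z]" a b] X(1) by (simp only: linear_map_neg[OF B_left] length_list_update)
  qed
qed

lemma lie_F:
  assumes "length X = n"
  shows "lie y (F X) = (\<Sum>i<n. F (X[i := lie y (X ! i)]))"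
  using F_invariant assms by (simp add: invariant_cochain_def)

text \<open>Equivalently, \<open>\<iota>\<^sub>e \<omega>\<close> is closed for every \<open>e\<close>, where \<open>\<omega>\<close> is the invariant form \<open>hat B F\<close>.\<close>

lemma lie_F_exchange:
  assumes X: "length X = n"
  shows "lie y (F X) = (\<Sum>i<n. lie (X ! i) (F (X[i := y])))"
proof -
  \<comment> \<open>Paired with \<open>e\<close>, the first term becomes -B([e, F X], y). Invariance
    of \<open>F\<close> expands it, and \<open>B_F_skew\<close> exchanges \<open>y\<close> with the
    bracketed argument of each summand.\<close>
  have "B (lie y (F X) - (\<Sum>i<n. lie (X ! i) (F (X[i := y])))) e = 0" for e
  proof -
    have summand: "B (lie (X ! i) (F (X[i := y]))) e = - B (F (X[i := lie e (X ! i)])) y"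
      if "i < n" for i
    proof -
      have "B (lie (X ! i) (F (X[i := y]))) e = B (F (X[i := y])) (lie e (X ! i))"
        by (simp add: B_invariant lie_skew[of "X ! i" e] linear_map_neg[OF B_right])
      also have "\<dots> = - B (F (X[i := lie e (X ! i)])) y"
        by (rule B_F_skew[OF X that])
      finally show ?thesis .
    qed
    have "B (lie y (F X)) e = B (F X) (lie e y)"
      by (simp add: B_invariant lie_skew[of y e] linear_map_neg[OF B_right])
    also have "\<dots> = - B (lie e (F X)) y"
      by (simp add: B_invariant)
    also have "\<dots> = (\<Sum>i<n. B (lie (X ! i) (F (X[i := y]))) e)"
      by (simp add: lie_F[OF X] linear_map_sum[OF B_left] summand sum_negf)
    finally show ?thesis
      by (simp add: linear_map_diff[OF B_left] linear_map_sum[OF B_left])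
  qed
  from B_nondegenerate[OF this] show ?thesis
    by simp
qed

text \<open>Invariance of \<open>F\<close> and cyclicity of the trace give K(u, F X) as the sum of
  the \<open>P j\<close>. The \<open>B\<close>-adjoint of v -> F(.., [u, [X_j, v]], ..) is v ->
  -[X_j, [u, F(.., v, ..)]], so its trace is -P j; by Jacobi the trace with [[X_j, u], v] is then 2
  P j.\<close>

lemma killing_F:
  assumes X: "length X = n"
  shows "2 * killing u (F X) = (\<Sum>j<n. lin_trace (\<lambda>v. F (X[j := lie (lie (X ! j) u) v])))"
proof -
  define P where "P j = lin_trace (\<lambda>v. F (X[j := lie (X ! j) (lie u v)]))" for j
  have lin_F_lie: "lin (\<lambda>v. F (X[j := lie x v]))" if "j < n" for j x
    by (rule linear_map_comp[OF F_linear[OF X that] lie_linear_right])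
  have "lie (F X) v = (\<Sum>j<n. F (X[j := lie (X ! j) v]))" for v
  proof -
    have "lie (F X) v = - lie v (F X)"
      by (rule lie_skew)
    also have "\<dots> = (\<Sum>j<n. - F (X[j := lie v (X ! j)]))"
      by (simp add: lie_F[OF X] sum_negf)
    also have "\<dots> = (\<Sum>j<n. F (X[j := lie (X ! j) v]))"
      by (rule sum.cong) (simp_all add: lie_skew[of v] linear_map_neg[OF F_linear[OF X]])
    finally show ?thesis .
  qed
  then have "killing u (F X) = (\<Sum>j<n. lin_trace (\<lambda>v. lie u (F (X[j := lie (X ! j) v]))))"
    by (simp add: killing_def lie_sum_right trace_sum)
  also have "\<dots> = (\<Sum>j<n. P j)"
    unfolding P_def
    by (rule sum.cong) (auto intro: trace_comm lie_linear_right lin_F_lie)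
  finally have killing: "killing u (F X) = (\<Sum>j<n. P j)" .
  have adjoint: "lin_trace (\<lambda>v. F (X[j := lie u (lie (X ! j) v)])) = - P j" if j: "j < n" for j
  proof -
    let ?x = "X ! j"
    have B_right_lie: "B y (lie x z) = - B (lie x y) z" for x y z
      by (simp add: B_invariant)
    have lin_lie_F: "lin (\<lambda>v. lie u (F (X[j := v])))"
      by (rule linear_map_comp[OF lie_linear_right F_linear[OF X j]])
    then have lin_lie_lie_F: "lin (\<lambda>v. lie ?x (lie u (F (X[j := v]))))"
      by (rule linear_map_comp[OF lie_linear_right])
    have "lin_trace (\<lambda>v. F (X[j := lie u (lie ?x v)]))
        = lin_trace (\<lambda>v. - lie ?x (lie u (F (X[j := v]))))"
    proof (rule trace_adjoint[of B])
      show "y = 0" if "\<And>x. B x y = 0" for y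
        using B_nondegenerate[of y] that by (simp add: B_sym)
      show "lin (\<lambda>v. F (X[j := lie u (lie ?x v)]))"
        by (rule linear_map_comp[OF lin_F_lie[OF j] lie_linear_right])
      show "lin (\<lambda>v. - lie ?x (lie u (F (X[j := v]))))"
        by (rule linI)
           (simp_all add: linear_map_add[OF lin_lie_lie_F] linear_map_scale[OF lin_lie_lie_F])
      fix v w
      have "B (F (X[j := lie u (lie ?x v)])) w = - B (lie ?x (lie u (F (X[j := w])))) v"
        by (subst B_F_skew[OF X j]) (simp only: B_right_lie minus_minus)
      then show "B (F (X[j := lie u (lie ?x v)])) w = B v (- lie ?x (lie u (F (X[j := w]))))"
        by (simp add: linear_map_neg[OF B_right] B_sym[of v])
    qed (rule B_left B_right)+
    also have "\<dots> = - lin_trace (\<lambda>v. lie ?x (lie u (F (X[j := v]))))"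
      by (rule trace_neg)
    also have "lin_trace (\<lambda>v. lie ?x (lie u (F (X[j := v])))) = P j"
      unfolding P_def
      using trace_comm[OF linear_map_comp[OF lie_linear_right lie_linear_right] F_linear[OF X j]] .
    finally show ?thesis .
  qed
  have "lin_trace (\<lambda>v. F (X[j := lie (lie (X ! j) u) v])) = 2 * P j" if j: "j < n" for j
  proof -
    have "F (X[j := lie (lie (X ! j) u) v])
        = F (X[j := lie (X ! j) (lie u v)]) - F (X[j := lie u (lie (X ! j) v)])" for v
      by (simp add: lie_lie_left linear_map_diff[OF F_linear[OF X j]])
    then show ?thesis
      by (simp add: trace_diff adjoint[OF j] flip: P_def)
  qed
  then show ?thesis
    by (simp add: killing sum_distrib_left)
qed

text \<open>\<open>R\<close> compares \<open>B\<close> with the Killing form, whose nondegeneracy is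
  where semisimplicity enters. It commutes with every \<open>lie x\<close> because both forms are
  invariant.\<close>

lemma killing_representation:
  assumes "semisimple"
  obtains R where "lin R" "\<And>x y. killing (R x) y = B x y" "\<And>x y. lie x (R y) = R (lie x y)"
proof -
  have nd: "x = 0" if "\<And>y. killing x y = 0" for x
    by (rule killing_nondegenerate[OF assms that])
  have "\<exists>z. \<forall>y. killing z y = B x y" for x
    using riesz[of killing, OF killing_functional_left killing_functional_right _ B_right[of x]] nd
    by (metis killing_sym)
  then obtain R where R: "\<And>x y. killing (R x) y = B x y"
    by metis
  have unique: "a = b" if "\<And>y. killing a y = killing b y" for a b
    using nd[of "a - b"] that by (simp add: linear_map_diff[OF killing_functional_left])
  have "lin R"
    by (rule linI; rule unique)
       (simp_all add: R linear_map_add[OF killing_functional_left] linear_map_add[OF B_left]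
         linear_map_scale[OF killing_functional_left] linear_map_scale[OF B_left])
  moreover have "lie x (R y) = R (lie x y)" for x y
    by (rule unique) (simp add: R killing_invariant B_invariant)
  ultimately show ?thesis
    using that R by blast
qed

section \<open>Vanishing of the antisymmetrised composition of \<open>F\<close> with itself\<close>

text \<open>With Z the first n and W the last m arguments, 2 B(F Z, F(y, W)) is expanded by
  \<open>killing_F\<close> along (y, W) and along Z. After alternation the first expansion leaves
  \<open>s\<close>, the second \<open>t 0\<close>, and these are opposite.\<close>

lemma alternation_B_F_F:
  assumes ss: "semisimple" and n: "n = Suc m" and m: "odd m" and X: "length X = n + m"
  shows "alternation (n + m) (\<lambda>X. B (F (take n X)) (F (y # drop n X))) X = 0"
proof -
  obtain R where R: "lin R" and killing_R: "\<And>x y. killing (R x) y = B x y"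
    and lie_R: "\<And>x y. lie x (R y) = R (lie x y)"
    using killing_representation[OF ss] by blast
  \<comment> \<open>\<open>\<phi> j X w\<close> is linear in \<open>w\<close> and does not see entry
    \<open>j\<close> of \<open>X\<close>, which is overwritten; the exchanges below rest on
    this.\<close>
  define \<phi> where "\<phi> j X w = lin_trace (\<lambda>v. F (X[j := lie (R w) v]))" for j X w
  have \<phi>: "functional (\<phi> j X)" if "length X = n" "j < n" for j X
    unfolding \<phi>_def
    by (rule functionalI)
       (simp_all add: linear_map_add[OF R] linear_map_scale[OF R] lie_add_left lie_scale_left
         linear_map_add[OF F_linear[OF that]] linear_map_scale[OF F_linear[OF that]]
         trace_add trace_scale)
  have B_F_F: "2 * B (F Z) (F X) = (\<Sum>j<n. \<phi> j X (lie (X ! j) (F Z)))" if "length X = n" for X Z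
    using killing_F[OF that, of "R (F Z)"] by (simp add: killing_R lie_R \<phi>_def)
  define f where "f X = B (F (take n X)) (F (y # drop n X))" for X
  \<comment> \<open>\<open>s\<close> and \<open>g j\<close> are the terms of the expansion along (y,
    W), at \<open>y\<close> and at W_j; \<open>h j\<close> is the term at Z_j of the expansion along
    Z, and \<open>t j\<close> the part of it in which \<open>y\<close> is exchanged into the outer
    bracket.\<close>
  define s where "s X = \<phi> 0 (y # drop n X) (lie y (F (take n X)))" for X
  define g where "g j X = \<phi> (Suc j) (y # drop n X) (lie (drop n X ! j) (F (take n X)))" for j X
  define h where "h j X = \<phi> j (take n X) (lie (take n X ! j) (F (y # drop n X)))" for j X
  define t where "t j X = \<phi> j (take n X) (lie y (F (take n X ! j # drop n X)))" for j X
  let ?alt = "\<lambda>f. alternation (n + m) f X"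
  have alt_transpose: "?alt (\<lambda>X. f (permute_list (Transposition.transpose i j) X)) = - ?alt f"
    if "i < n + m" "j < n + m" "i \<noteq> j" for f :: "'g list \<Rightarrow> complex" and i j
    by (rule alternation_transpose[OF X that])

  \<comment> \<open>\<open>lie_F_exchange\<close> trades W_j for each Z_i in turn. As
    \<open>\<phi>\<close> ignores the slot of W_j, each summand is \<open>g j\<close> at transposed
    arguments.\<close>
  have g_rec: "g j X = (\<Sum>i<n. g j (permute_list (Transposition.transpose i (n + j)) X))"
    if X: "length X = n + m" and j: "j < m" for X j
  proof -
    have len: "length (take n X) = n" "length (y # drop n X) = n"
      using X n by simp_all
    have "g j X = (\<Sum>i<n. \<phi> (Suc j) (y # drop n X)
        (lie (take n X ! i) (F ((take n X)[i := drop n X ! j]))))"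
      unfolding g_def lie_F_exchange[OF len(1), of "drop n X ! j"]
      by (rule linear_map_sum[OF \<phi>[OF len(2)]]) (use j n in simp)
    also have "\<dots> = (\<Sum>i<n. g j (permute_list (Transposition.transpose i (n + j)) X))"
    proof (rule sum.cong[OF refl])
      fix i assume "i \<in> {..<n}"
      then have i: "i < n"
        by simp
      show "\<phi> (Suc j) (y # drop n X) (lie (take n X ! i) (F ((take n X)[i := drop n X ! j])))
          = g j (permute_list (Transposition.transpose i (n + j)) X)"
        unfolding g_def \<phi>_def take_drop_transpose_across[OF X i j] using X j i by simp
    qed
    finally show ?thesis .
  qed
  \<comment> \<open>Every transposition flips the sign, so the alternation equals -n times
    itself.\<close>
  have alt_g: "?alt (g j) = 0" if j: "j < m" for j
  proof -
    have "?alt (g j) = ?alt (\<lambda>X. \<Sum>i<n. g j (permute_list (Transposition.transpose i (n + j)) X))"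
      by (rule alternation_cong[OF X]) (rule g_rec[OF _ j])
    also have "\<dots> = (\<Sum>i<n. - ?alt (g j))"
      unfolding alternation_sum by (rule sum.cong) (use j in \<open>auto intro!: alt_transpose\<close>)
    finally have "(1 + of_nat n) * ?alt (g j) = 0"
      by (simp add: distrib_right eq_neg_iff_add_eq_0)
    moreover have "(1 + of_nat n :: complex) \<noteq> 0"
      using of_nat_neq_0[of n, where 'a = complex] by (simp add: add.commute)
    ultimately show ?thesis
      by simp
  qed
  have "2 * f X = s X + (\<Sum>j<m. g j X)" if X: "length X = n + m" for X
    unfolding f_def using B_F_F[of "y # drop n X" "take n X"] X n
    by (simp add: sum.lessThan_Suc_shift s_def g_def del: sum.lessThan_Suc)
  then have "?alt (\<lambda>X. 2 * f X) = ?alt (\<lambda>X. s X + (\<Sum>j<m. g j X))"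
    by (intro alternation_cong[OF X])
  then have f_s: "2 * ?alt f = ?alt s"
    by (simp add: alternation_scale alternation_add alternation_sum alt_g)

  \<comment> \<open>The same exchange over the n arguments of F(y, W): \<open>y\<close> yields
    \<open>t j\<close>, the m entries of W yield transposed copies of \<open>h j\<close>.\<close>
  have h_rec: "h j X = t j X + (\<Sum>i<m. h j (permute_list (Transposition.transpose j (n + i)) X))"
    if X: "length X = n + m" and j: "j < n" for X j
  proof -
    have len: "length (take n X) = n" "length (y # drop n X) = n"
      using X n by simp_all
    have "h j X = (\<Sum>i<n. \<phi> j (take n X)
        (lie ((y # drop n X) ! i) (F ((y # drop n X)[i := take n X ! j]))))"
      unfolding h_def lie_F_exchange[OF len(2), of "take n X ! j"]
      by (rule linear_map_sum[OF \<phi>[OF len(1) j]])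
    also have "\<dots> = t j X + (\<Sum>i<m. \<phi> j (take n X)
        (lie (drop n X ! i) (F (y # (drop n X)[i := take n X ! j]))))"
      unfolding n sum.lessThan_Suc_shift by (simp add: t_def n)
    also have "(\<Sum>i<m. \<phi> j (take n X) (lie (drop n X ! i) (F (y # (drop n X)[i := take n X ! j]))))
        = (\<Sum>i<m. h j (permute_list (Transposition.transpose j (n + i)) X))"
    proof (rule sum.cong[OF refl])
      fix i assume "i \<in> {..<m}"
      then have i: "i < m"
        by simp
      show "\<phi> j (take n X) (lie (drop n X ! i) (F (y # (drop n X)[i := take n X ! j])))
          = h j (permute_list (Transposition.transpose j (n + i)) X)"
        unfolding h_def \<phi>_def take_drop_transpose_across[OF X j i] using X j i by simp
    qed
    finally show ?thesis .
  qed
  \<comment> \<open>The copies contribute -m times the left side; moved over, they make the factor m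
    + 1 = n.\<close>
  have alt_h: "of_nat n * ?alt (h j) = ?alt (t j)" if j: "j < n" for j
  proof -
    have "?alt (h j) = ?alt (\<lambda>X. t j X + (\<Sum>i<m. h j (permute_list (Transposition.transpose j (n + i)) X)))"
      by (rule alternation_cong[OF X]) (rule h_rec[OF _ j])
    also have "\<dots> = ?alt (t j) + (\<Sum>i<m. - ?alt (h j))"
      unfolding alternation_add alternation_sum
      by (intro arg_cong2[of _ _ _ _ "(+)"] refl sum.cong) (use j in \<open>auto intro!: alt_transpose\<close>)
    finally show ?thesis
      by (simp add: n algebra_simps)
  qed
  \<comment> \<open>Transposing arguments 0 and j turns \<open>t j\<close> into -\<open>t 0\<close>
    by skewness of \<open>F\<close>, and the sign of the transposition cancels the minus.\<close>
  have alt_t: "?alt (t j) = ?alt (t 0)" if j: "j < n" for j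
  proof (cases "j = 0")
    case False
    have "t j (permute_list (Transposition.transpose 0 j) X) = - t 0 X"
      if X: "length X = n + m" for X
    proof -
      have swap: "F ((take n X)[0 := X ! j, j := z]) = - F ((take n X)[0 := z])" for z
      proof -
        have "(take n X)[0 := z, j := X ! j] = (take n X)[0 := z]"
          using j False X by (intro nth_equalityI) (auto simp: nth_list_update)
        then show ?thesis
          using F_swap[of "take n X" 0 j "X ! j" z] X j False n by simp
      qed
      show ?thesis
        using j n X False take_drop_transpose_within[OF X, of 0 j]
        by (simp add: t_def \<phi>_def swap[unfolded n] trace_neg)
    qed
    then have "?alt (\<lambda>X. t j (permute_list (Transposition.transpose 0 j) X)) = ?alt (\<lambda>X. - t 0 X)"
      by (intro alternation_cong[OF X])
    then show ?thesis
      using alt_transpose[of 0 j "t j"] j False n by (simp add: alternation_neg)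
  qed simp
  have "2 * f X = (\<Sum>j<n. h j X)" if X: "length X = n + m" for X
    unfolding f_def h_def B_sym[of "F (take n X)"] using X by (intro B_F_F) simp
  then have "?alt (\<lambda>X. 2 * f X) = ?alt (\<lambda>X. \<Sum>j<n. h j X)"
    by (intro alternation_cong[OF X])
  then have "2 * ?alt f = (\<Sum>j<n. ?alt (h j))"
    by (simp add: alternation_scale alternation_sum)
  then have "of_nat n * (2 * ?alt f) = (\<Sum>j<n. of_nat n * ?alt (h j))"
    by (simp only: sum_distrib_left)
  also have "\<dots> = (\<Sum>j<n. ?alt (t 0))"
  proof (rule sum.cong[OF refl])
    fix j assume "j \<in> {..<n}"
    then have j: "j < n"
      by simp
    show "of_nat n * ?alt (h j) = ?alt (t 0)"
      using alt_h[OF j] alt_t[OF j] by (rule trans)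
  qed
  finally have "of_nat n * (2 * ?alt f) = of_nat n * ?alt (t 0)"
    by simp
  moreover have "n \<noteq> 0"
    using n by simp
  ultimately have f_t: "2 * ?alt f = ?alt (t 0)"
    by simp

  \<comment> \<open>The first argument stays in F Z while the rest of Z trades places with W; slot 0
    under \<open>\<phi>\<close> is ignored, so its content may differ.\<close>
  have "s X = t 0 (permute_list (block_swap 1 n m) X)" if X: "length X = n + m" for X
  proof -
    have "X ! 0 # tl (take n X) = take n X"
      using X n by (cases X) simp_all
    then show ?thesis
      unfolding s_def t_def take_drop_block_swap[OF X n] \<phi>_def by simp
  qed
  then have "?alt s = ?alt (\<lambda>X. t 0 (permute_list (block_swap 1 n m) X))"
    by (intro alternation_cong[OF X])
  also have "\<dots> = - ?alt (t 0)"
    using alternation_permute[OF X, of "block_swap 1 n m" "t 0"] block_swap_permutes[of 1 m n "n + m"] n m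
    by simp
  finally have "2 * ?alt f = - (2 * ?alt f)"
    by (simp only: f_s[symmetric] f_t[symmetric])
  then have "?alt f = 0"
    by simp
  then show ?thesis
    by (simp add: f_def[abs_def])
qed

lemma alternating_sum_F_F:
  assumes "semisimple" "n = Suc m" "odd m" "length X = n + m"
  shows "(\<Sum>\<sigma> | \<sigma> permutes {..<n + m}. scale (of_int (sign \<sigma>))
      (F (F (take n (permute_list \<sigma> X)) # drop n (permute_list \<sigma> X)))) = 0"
proof (rule B_nondegenerate)
  fix y
  \<comment> \<open>The entry 0 in \<open>0 # W\<close> is a placeholder that the updates
    overwrite.\<close>
  have "B (F (F Z # W)) y = - B (F Z) (F (y # W))" if "length W = m" for Z W
    using B_F_skew[of "0 # W" 0 "F Z" y] that assms(2) B_sym[of "F (y # W)" "F Z"] by simp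
  then have "B (\<Sum>\<sigma> | \<sigma> permutes {..<n + m}. scale (of_int (sign \<sigma>))
      (F (F (take n (permute_list \<sigma> X)) # drop n (permute_list \<sigma> X)))) y
      = - alternation (n + m) (\<lambda>X. B (F (take n X)) (F (y # drop n X))) X"
    using assms(4)
    by (simp add: linear_map_sum[OF B_left] linear_map_scale[OF B_left] alternation_def sum_negf)
  then show "B (\<Sum>\<sigma> | \<sigma> permutes {..<n + m}. scale (of_int (sign \<sigma>))
      (F (F (take n (permute_list \<sigma> X)) # drop n (permute_list \<sigma> X)))) y = 0"
    using alternation_B_F_F[OF assms] by simp
qed

text \<open>Skewness of the inner and of the outer \<open>F\<close> makes the signed summand
  invariant under the Young subgroup, so the full alternating sum is the nonzero order of that
  subgroup times the shuffle sum.\<close>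

lemma shuffle_sum_F_F:
  assumes "semisimple" "n = Suc m" "odd m" "length X = n + m"
  shows "(\<Sum>\<sigma>\<in>shuffles n m. scale (of_int (sign \<sigma>))
      (F (F (take n (permute_list \<sigma> X)) # drop n (permute_list \<sigma> X)))) = 0"
proof -
  define G where "G L = F (F (take n L) # drop n L)" for L
  define g where "g \<sigma> = scale (of_int (sign \<sigma>)) (G (permute_list \<sigma> X))" for \<sigma>
  have G_transpose: "G (permute_list (Transposition.transpose a b) L) = - G L"
    if L: "length L = n + m" and "a \<noteq> b"
      and ab: "(a < n \<and> b < n) \<or> (n \<le> a \<and> a < n + m \<and> n \<le> b \<and> b < n + m)" for L a b
    using ab
  proof
    assume ab: "a < n \<and> b < n"
    have "take n (permute_list (Transposition.transpose a b) L)
        = permute_list (Transposition.transpose a b) (take n L)"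
      using ab L by (simp add: permute_list_transpose take_update_swap)
    then have "F (take n (permute_list (Transposition.transpose a b) L)) = - F (take n L)"
      using F_transpose[of "take n L" a b] ab L \<open>a \<noteq> b\<close> by simp
    moreover have "F (- z # drop n L) = - F (z # drop n L)" for z
      using linear_map_neg[OF F_linear[of "0 # drop n L" 0]] L assms(2) by simp
    ultimately show ?thesis
      using ab by (simp add: G_def take_drop_transpose_within[OF L])
  next
    assume ab: "n \<le> a \<and> a < n + m \<and> n \<le> b \<and> b < n + m"
    \<comment> \<open>Shifted by one, since the value of the inner \<open>F\<close> occupies
      position 0 of the outer argument list.\<close>
    let ?t = "Transposition.transpose (Suc (a - n)) (Suc (b - n))"
    have "take n (permute_list (Transposition.transpose a b) L) = take n L"
      using ab L by (simp add: permute_list_transpose)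
    moreover have "z # drop n (permute_list (Transposition.transpose a b) L)
        = permute_list ?t (z # drop n L)" for z
    proof -
      have "Suc (a - n) < length (z # drop n L)" "Suc (b - n) < length (z # drop n L)"
        using ab L by auto
      from permute_list_transpose[OF this] show ?thesis
        using ab L by (simp add: permute_list_transpose drop_update_swap)
    qed
    moreover have "F (permute_list ?t (z # drop n L)) = - F (z # drop n L)" for z
      using ab L \<open>a \<noteq> b\<close> assms(2) by (intro F_transpose) auto
    ultimately show ?thesis
      by (simp add: G_def)
  qed
  have g_transpose: "g (\<sigma> \<circ> Transposition.transpose a b) = g \<sigma>"
    if \<sigma>: "\<sigma> permutes {..<n + m}" and "a \<noteq> b"
      and ab: "(a < n \<and> b < n) \<or> (n \<le> a \<and> a < n + m \<and> n \<le> b \<and> b < n + m)" for \<sigma> a b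
  proof -
    have t: "Transposition.transpose a b permutes {..<n + m}"
      using ab by (intro permutes_swap_id) auto
    have "permutation \<sigma>" "permutation (Transposition.transpose a b)"
      using \<sigma> t permutes_imp_permutation by blast+
    then have "sign (\<sigma> \<circ> Transposition.transpose a b) = - sign \<sigma>"
      using \<open>a \<noteq> b\<close> by (simp only: sign_compose sign_swap_id) simp
    moreover have "permute_list (\<sigma> \<circ> Transposition.transpose a b) X
        = permute_list (Transposition.transpose a b) (permute_list \<sigma> X)"
      using t assms(4) by (intro permute_list_compose) simp
    ultimately show ?thesis
      using G_transpose[of "permute_list \<sigma> X" a b] assms(4) \<open>a \<noteq> b\<close> ab by (simp only: g_def) simp
  qed
  have "(\<Sum>\<sigma> | \<sigma> permutes {..<n + m}. g \<sigma>) = (\<Sum>t\<in>young n m. \<Sum>\<sigma>\<in>shuffles n m. g \<sigma>)"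
  proof (rule sum_permutations_eq_shuffles)
    fix s t assume "s \<in> shuffles n m" "t \<in> young n m"
    then show "g (s \<circ> t) = g s"
      by (intro young_invariant[of n m g, OF g_transpose]) (auto simp: shuffles_def)
  qed
  then have "scale (of_nat (card (young n m))) (\<Sum>\<sigma>\<in>shuffles n m. g \<sigma>) = 0"
    using alternating_sum_F_F[OF assms] by (simp add: g_def G_def sum_constant_scale)
  moreover have "card (young n m) \<noteq> 0"
  proof -
    have "id \<in> young n m"
      by (simp only: young_def mem_Collect_eq permutes_id image_id id_apply simp_thms)
    moreover have "finite (young n m)"
      using finite_permutations[of "{..<n + m}"] by (simp add: young_def)
    ultimately show ?thesis
      by auto
  qed
  ultimately show ?thesis
    by (simp add: g_def G_def)
qed

text \<open>For p = q = m both sums of the bracket are the vanishing shuffle sum. As m * m is odd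
  they would reinforce, not cancel, each other.\<close>

lemma bracket_F_F:
  assumes "semisimple" "n = Suc m" "odd m" "length X = m + m + 1"
  shows "bracket_a scale m m F F X = 0"
  using shuffle_sum_F_F[OF assms(1-3), of X] assms by (simp add: bracket_a_def)

end

theorem proposition9p2p1:
  fixes scale :: "complex \<Rightarrow> 'g::ab_group_add \<Rightarrow> 'g"
    and Basis :: "'g set"
    and lie :: "'g \<Rightarrow> 'g \<Rightarrow> 'g"
    and B :: "'g \<Rightarrow> 'g \<Rightarrow> complex"
    and k :: nat
    and F :: "'g list \<Rightarrow> 'g"
  assumes "finite_dimensional_vector_space scale Basis"
    and "lie_algebra scale lie"
    and "lie_algebra.semisimple scale lie"
    and "bilinear_form scale B"
    and "symmetric_form B"
    and "nondegenerate_form B"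
    and "invariant_form lie B"
    and "k \<ge> 1"
    and "F \<in> skew_cochains scale (2 * k)"
    and "cyclic_cochain B (2 * k) F"
    and "invariant_cochain lie (2 * k) F"
  shows "even_lie_structure scale k F \<and> quadratic B k F"
proof -
  interpret finite_dimensional_vector_space scale Basis
    by fact
  interpret lie_algebra scale lie
    by fact
  interpret fd_lie_algebra scale Basis lie
    by unfold_locales
  have B_left: "functional (\<lambda>x. B x y)" and B_right: "functional (\<lambda>y. B x y)" for x y
    using assms(4) by (auto simp: bilinear_form_def)
  have B_sym: "B x y = B y x" for x y
    using assms(5) by (simp add: symmetric_form_def)
  have quadratic_F: "B (F (Ys @ [y])) z = - B y (F (Ys @ [z]))"
    if "length Ys + 1 = 2 * k" for Ys y z
    by (rule quadratic_if_cyclic[of B, OF B_left B_sym assms(9,10) _ that]) simp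
  interpret quadratic_cochain scale Basis lie B "2 * k" F
  proof (intro quadratic_cochain.intro quadratic_cochain_axioms.intro)
    show "B (lie x y) z = - B y (lie x z)" for x y z
      using assms(7) unfolding invariant_form_def by blast
    show "x = 0" if "\<And>y. B x y = 0" for x
      using assms(6) that unfolding nondegenerate_form_def by blast
  qed (fact fd_lie_algebra_axioms B_left B_right B_sym assms(9,11) quadratic_F)+
  \<comment> \<open>Here n = 2k and m = 2k - 1; \<open>k \<ge> 1\<close> makes the natural
    subtraction exact, so that n = Suc m and m is odd.\<close>
  have "bracket_a scale (2 * k - 1) (2 * k - 1) F F X = 0"
    if "length X = (2 * k - 1) + (2 * k - 1) + 1" for X
    using that assms(3,8) by (intro bracket_F_F) auto
  then show ?thesis
    unfolding even_lie_structure_def quadratic_def using assms(8,9) quadratic_F by simp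
qed

end
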